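(* Let $\varepsilon\in(0,1]$ and $f:U_\varepsilon(\Omega)\to\mathbb C$. Then $f$ is smooth with respect to $\tau_{2,\varepsilon}$ if and only if for every compact $H\subseteq\mathbb R^s$ and every open $V\subseteq\Omega$ such that $\mathcal A_{0,H}(\mathbb R^s)\times V\subseteq U_{\varepsilon,N}(\Omega)$ for some compact $N\subseteq\Omega$, the restriction of $f$ to $\mathcal A_{0,H}(\mathbb R^s)\times V$ is smooth with respect to (the restriction of) $\tau_{1,\varepsilon}$.
   Context: $\Omega\subseteq\mathbb R^s$ open. $\mathcal A_0(\mathbb R^s)=\{\varphi\in\mathcal D(\mathbb R^s):\int\varphi=1\}$, $\mathcal A_0(\Omega)=\mathcal A_0(\mathbb R^s)\cap\mathcal D(\Omega)$, and $\mathcal A_{0,H}(\mathbb R^s)=\{\varphi\in\mathcal A_0(\mathbb R^s):\operatorname{supp}\varphi\subseteq H\}$. $(S_\varepsilon\varphi)(\xi)=\varepsilon^{-s}\varphi(\xi/\varepsilon)$, $(T_x\varphi)(\xi)=\varphi(\xi-x)$, $T(\varphi,x)=(T_x\varphi,x)$, $S^{(\varepsilon)}(\varphi,x)=(S_\varepsilon\varphi,x)$. $U_\varepsilon(\Omega)=\{(\varphi,x)\in\mathcal A_0(\mathbb R^s)\times\Omega:\operatorname{supp}\varphi\subseteq\varepsilon^{-1}(\Omega-x)\}$, $U_{\varepsilon,N}(\Omega)=\{(\varphi,x)\in\mathcal A_0(\mathbb R^s)\times\Omega:\operatorname{supp}\varphi\subseteq\varepsilon^{-1}(N-x)\}$.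 $\tau_{1,\varepsilon}$: topology on $U_\varepsilon(\Omega)$ induced from $\mathcal A_0(\mathbb R^s)\times\mathbb R^s$; $\tau_{2,\varepsilon}$: topology and smooth structure transported from $\mathcal A_0(\Omega)\times\Omega$ (with the topology of $\mathcal D(\Omega)$ times Euclidean) via the bijection $T\circ S^{(\varepsilon)}$; thus $f$ is $\tau_{2,\varepsilon}$-smooth iff $f\circ(T\circ S^{(\varepsilon)})^{-1}$ is smooth on $\mathcal A_0(\Omega)\times\Omega$. Smoothness is in the convenient sense (smooth curves to smooth curves), affine subspaces being identified with their parallel linear subspaces. *)

theory Defs
  imports "HOL-Analysis.Analysis"
begin

definition tsupp :: "('a::real_normed_vector \<Rightarrow> complex) \<Rightarrow> 'a set" where
  "tsupp \<phi> = closure {x. \<phi> x \<noteq> 0}"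

fun pd :: "'a::euclidean_space list \<Rightarrow> ('a \<Rightarrow> complex) \<Rightarrow> 'a \<Rightarrow> complex" where
  "pd [] \<phi> = \<phi>"
| "pd (v # vs) \<phi> = (\<lambda>x. frechet_derivative (pd vs \<phi>) (at x) v)"

definition smooth_fun :: "('a::euclidean_space \<Rightarrow> complex) \<Rightarrow> bool" where
  "smooth_fun \<phi> \<longleftrightarrow> (\<forall>vs. set vs \<subseteq> Basis \<longrightarrow> (\<forall>x. pd vs \<phi> differentiable (at x)))"

definition testfns :: "'a::euclidean_space set \<Rightarrow> ('a \<Rightarrow> complex) set" where
  "testfns \<Omega> = {\<phi>. smooth_fun \<phi> \<and> compact (tsupp \<phi>) \<and> tsupp \<phi> \<subseteq> \<Omega>}"

definition A0 :: "'a::euclidean_space set \<Rightarrow> ('a \<Rightarrow> complex) set" where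
  "A0 \<Omega> = {\<phi> \<in> testfns \<Omega>. integral UNIV \<phi> = 1}"

definition A0H :: "'a::euclidean_space set \<Rightarrow> ('a \<Rightarrow> complex) set" where
  "A0H H = {\<phi> \<in> A0 UNIV. tsupp \<phi> \<subseteq> H}"

definition supnorm :: "('a \<Rightarrow> complex) \<Rightarrow> real" where
  "supnorm g = Sup (range (\<lambda>x. norm (g x)))"

definition dirs :: "nat \<Rightarrow> 'a::euclidean_space list set" where
  "dirs m = {vs. set vs \<subseteq> Basis \<and> length vs \<le> m}"

text \<open>Continuous seminorms of the (strict inductive limit) LF topology of D(Omega):
  seminorms whose restriction to each D_K (K compact in Omega) is continuous.\<close>
definition cont_seminorm :: "'a::euclidean_space set \<Rightarrow> (('a \<Rightarrow> complex) \<Rightarrow> real) \<Rightarrow> bool" where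
  "cont_seminorm \<Omega> p \<longleftrightarrow>
     (\<forall>\<phi>\<in>testfns \<Omega>. \<forall>\<psi>\<in>testfns \<Omega>. p (\<lambda>x. \<phi> x + \<psi> x) \<le> p \<phi> + p \<psi>) \<and>
     (\<forall>c. \<forall>\<phi>\<in>testfns \<Omega>. p (\<lambda>x. c * \<phi> x) = norm c * p \<phi>) \<and>
     (\<forall>K. compact K \<and> K \<subseteq> \<Omega> \<longrightarrow>
        (\<exists>C m. \<forall>\<phi>\<in>testfns \<Omega>. tsupp \<phi> \<subseteq> K \<longrightarrow>
           p \<phi> \<le> C * (\<Sum>vs\<in>dirs m. supnorm (pd vs \<phi>))))"

text \<open>Smooth curves R -> D(Omega) (convenient sense: all iterated derivatives exist
  as limits of difference quotients in the topology of D(Omega)).\<close>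
definition smooth_curve_D :: "'a::euclidean_space set \<Rightarrow> (real \<Rightarrow> 'a \<Rightarrow> complex) \<Rightarrow> bool" where
  "smooth_curve_D \<Omega> c \<longleftrightarrow>
     (\<exists>d. d 0 = c \<and>
        (\<forall>k t. d k t \<in> testfns \<Omega>) \<and>
        (\<forall>k t p. cont_seminorm \<Omega> p \<longrightarrow>
           ((\<lambda>h. p (\<lambda>\<xi>. (d k (t + h) \<xi> - d k t \<xi>) / complex_of_real h - d (Suc k) t \<xi>))
              \<longlongrightarrow> 0) (at 0)))"

definition smooth_curve :: "(real \<Rightarrow> 'b::real_normed_vector) \<Rightarrow> bool" where
  "smooth_curve c \<longleftrightarrow>
     (\<exists>d. d 0 = c \<and> (\<forall>k t. (d k has_vector_derivative d (Suc k) t) (at t)))"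

text \<open>Convenient smoothness of g on A \<times> V, where A is a subset of an affine subspace of
  D(Omega') and V a subset of R^s: smooth curves are mapped to smooth curves.\<close>
definition conv_smooth_on ::
  "'a::euclidean_space set \<Rightarrow> ('a \<Rightarrow> complex) set \<Rightarrow> 'a set \<Rightarrow> (('a \<Rightarrow> complex) \<times> 'a \<Rightarrow> complex) \<Rightarrow> bool" where
  "conv_smooth_on \<Omega>' A V g \<longleftrightarrow>
     (\<forall>c1 c2. smooth_curve_D \<Omega>' c1 \<and> (\<forall>t. c1 t \<in> A) \<and> smooth_curve c2 \<and> (\<forall>t. c2 t \<in> V)
        \<longrightarrow> smooth_curve (\<lambda>t. g (c1 t, c2 t)))"

definition U_eps :: "real \<Rightarrow> 'a::euclidean_space set \<Rightarrow> (('a \<Rightarrow> complex) \<times> 'a) set" where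
  "U_eps \<epsilon> \<Omega> = {(\<phi>, x). \<phi> \<in> A0 UNIV \<and> x \<in> \<Omega> \<and> (\<forall>y\<in>tsupp \<phi>. x + \<epsilon> *\<^sub>R y \<in> \<Omega>)}"

definition U_epsN :: "real \<Rightarrow> 'a::euclidean_space set \<Rightarrow> 'a set \<Rightarrow> (('a \<Rightarrow> complex) \<times> 'a) set" where
  "U_epsN \<epsilon> \<Omega> N = {(\<phi>, x). \<phi> \<in> A0 UNIV \<and> x \<in> \<Omega> \<and> (\<forall>y\<in>tsupp \<phi>. x + \<epsilon> *\<^sub>R y \<in> N)}"

text \<open>Inverse of T \<circ> S^(eps): (psi, x) |-> (eta |-> eps^s psi(x + eps eta), x).\<close>
definition TS_inv :: "real \<Rightarrow> ('a::euclidean_space \<Rightarrow> complex) \<times> 'a \<Rightarrow> ('a \<Rightarrow> complex) \<times> 'a" where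
  "TS_inv \<epsilon> = (\<lambda>(\<psi>, x). (\<lambda>\<eta>. complex_of_real (\<epsilon> ^ DIM('a)) * \<psi> (x + \<epsilon> *\<^sub>R \<eta>), x))"

definition tau2_smooth :: "real \<Rightarrow> 'a::euclidean_space set \<Rightarrow> (('a \<Rightarrow> complex) \<times> 'a \<Rightarrow> complex) \<Rightarrow> bool" where
  "tau2_smooth \<epsilon> \<Omega> f \<longleftrightarrow> conv_smooth_on \<Omega> (A0 \<Omega>) \<Omega> (f \<circ> TS_inv \<epsilon>)"

definition tau1_smooth_on :: "('a::euclidean_space \<Rightarrow> complex) set \<Rightarrow> 'a set \<Rightarrow> (('a \<Rightarrow> complex) \<times> 'a \<Rightarrow> complex) \<Rightarrow> bool" where
  "tau1_smooth_on A V f \<longleftrightarrow> conv_smooth_on UNIV A V f"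

end

theory Submission
  imports Defs
begin

text \<open>
  A smooth curve \<open>c\<close> in the space of test functions is the same thing as a jointly smooth function
  \<open>(x, t) \<mapsto> c t x\<close>, provided the supports of the \<open>c t\<close> stay, locally in \<open>t\<close>, in a common compact
  set; the latter is automatic for the inductive limit topology. Joint smoothness is preserved by
  the substitution \<open>x \<mapsto> m x + b t\<close> underlying \<open>T \<circ> S\<^sup>(\<^sup>\<epsilon>\<^sup>)\<close>, for a smooth curve \<open>b\<close>. On a set
  \<open>A0H H \<times> V\<close> inside some \<open>U_epsN \<epsilon> \<Omega> N\<close> the transported curves keep their supports in \<open>N\<close>,
  which gives one direction. For the other, near each time \<open>t0\<close> a curve in \<open>A0 \<Omega> \<times> \<Omega>\<close> has supports in a
  compact \<open>K \<subseteq> \<Omega>\<close> and base points in a small ball \<open>V\<close> around \<open>c2 t0\<close>, so its pullback lies in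
  \<open>A0H H \<times> V\<close> with \<open>H = \<epsilon>\<^sup>-\<^sup>1 (K - cball (c2 t0) r)\<close>, and smoothness is a local property.
\<close>

subsection \<open>Smooth functions on Euclidean spaces\<close>

text \<open>The operators \<open>pd [v]\<close> serve as building blocks; unfolding them to
  \<open>frechet_derivative\<close> is left to explicit use.\<close>

declare pd.simps(2) [simp del]

lemma pd_append: "pd (us @ vs) \<phi> = pd us (pd vs \<phi>)"
  by (induction us) (auto simp: pd.simps(2))

lemma pd_Cons: "pd (v # vs) \<phi> = pd [v] (pd vs \<phi>)"
  by (simp add: pd.simps(2))

lemma smooth_fun_differentiable: "smooth_fun \<phi> \<Longrightarrow> \<phi> differentiable at x"
  unfolding smooth_fun_def by (metis empty_set empty_subsetI pd.simps(1))

lemma smooth_fun_pd: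
  assumes "smooth_fun \<phi>" "set us \<subseteq> Basis"
  shows "smooth_fun (pd us \<phi>)"
  unfolding smooth_fun_def
proof (intro allI impI)
  fix vs :: "'a list" and x
  assume "set vs \<subseteq> Basis"
  then have "pd (vs @ us) \<phi> differentiable at x"
    using assms unfolding smooth_fun_def by (metis Un_least set_append)
  then show "pd vs (pd us \<phi>) differentiable at x"
    by (simp add: pd_append)
qed

text \<open>Iterated derivatives never leave \<open>F\<close>, so all of them are differentiable.
  Smoothness thus reduces to guessing an invariant family, without induction on the order of
  differentiation.\<close>

lemma smooth_fun_coinduct:
  assumes "\<phi> \<in> F"
    and "\<And>w x. w \<in> F \<Longrightarrow> w differentiable at x"
    and "\<And>w v. w \<in> F \<Longrightarrow> v \<in> Basis \<Longrightarrow> pd [v] w \<in> F"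
  shows "smooth_fun \<phi>"
proof -
  have "pd vs \<phi> \<in> F" if "set vs \<subseteq> Basis" for vs
    using that
  proof (induction vs)
    case (Cons v vs)
    then have "pd [v] (pd vs \<phi>) \<in> F"
      by (intro assms(3)) auto
    then show ?case by (simp add: pd_Cons[of v vs])
  qed (use assms in simp)
  then show ?thesis
    unfolding smooth_fun_def using assms(2) by blast
qed

lemma pd_single_eqI: "(w has_derivative D) (at x) \<Longrightarrow> pd [v] w x = D v"
  by (simp add: pd.simps frechet_derivative_at[symmetric])

lemma smooth_fun_has_derivative:
  "smooth_fun w \<Longrightarrow> (w has_derivative (\<lambda>v. pd [v] w x)) (at x)"
  using smooth_fun_differentiable frechet_derivative_works by (fastforce simp: pd.simps)

text \<open>The unital complex algebra generated by \<open>B\<close> under pointwise operations;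
  scalar multiples arise from \<open>const\<close> and \<open>mult\<close>.\<close>

inductive_set alg_hull :: "('a \<Rightarrow> complex) set \<Rightarrow> ('a \<Rightarrow> complex) set"
  for B where
  base: "w \<in> B \<Longrightarrow> w \<in> alg_hull B"
| const: "(\<lambda>x. c) \<in> alg_hull B"
| add: "w \<in> alg_hull B \<Longrightarrow> w' \<in> alg_hull B \<Longrightarrow> (\<lambda>x. w x + w' x) \<in> alg_hull B"
| mult: "w \<in> alg_hull B \<Longrightarrow> w' \<in> alg_hull B \<Longrightarrow> (\<lambda>x. w x * w' x) \<in> alg_hull B"

lemma alg_hull_sum:
  assumes "\<And>i. i \<in> I \<Longrightarrow> w i \<in> alg_hull B"
  shows "(\<lambda>x. \<Sum>i\<in>I. w i x) \<in> alg_hull B"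
  using assms
  by (induction I rule: infinite_finite_induct) (auto intro: alg_hull.intros)

text \<open>Coinduction up to algebra operations: derivatives of the generators need only be
  polynomial expressions in generators and functions already known to be smooth.\<close>

lemma smooth_fun_coinduct_alg:
  fixes B :: "('a::euclidean_space \<Rightarrow> complex) set"
  assumes diff: "\<And>w x. w \<in> B \<Longrightarrow> w differentiable at x"
    and deriv: "\<And>w v. w \<in> B \<Longrightarrow> v \<in> Basis \<Longrightarrow> pd [v] w \<in> alg_hull (B \<union> Collect smooth_fun)"
    and "\<phi> \<in> alg_hull (B \<union> Collect smooth_fun)"
  shows "smooth_fun \<phi>"
proof (rule smooth_fun_coinduct[OF assms(3)])
  let ?A = "alg_hull (B \<union> Collect smooth_fun)"
  \<comment> \<open>Both properties are carried through one induction: the sum and product rules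
    express a derivative through hull elements and their derivatives, and need differentiability of
    the operands.\<close>
  have main: "(\<forall>x. w differentiable at x) \<and> (\<forall>v\<in>Basis. pd [v] w \<in> ?A)" if "w \<in> ?A" for w
    using that
  proof induction
    case (base w)
    then show ?case
      using diff deriv smooth_fun_differentiable smooth_fun_pd[of w "[v]" for v]
      by (auto intro: alg_hull.base)
  next
    case (const c)
    have "pd [v] (\<lambda>x. c) = (\<lambda>x. 0)" for v :: 'a by (simp add: pd.simps)
    then show ?case by (simp add: alg_hull.const)
  next
    case (add w w')
    have "pd [v] (\<lambda>x. w x + w' x) = (\<lambda>x. pd [v] w x + pd [v] w' x)" for v
    proof
      fix x
      have "((\<lambda>x. w x + w' x) has_derivative
          (\<lambda>v. frechet_derivative w (at x) v + frechet_derivative w' (at x) v)) (at x)"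
        using add.IH by (intro has_derivative_add) (auto simp: frechet_derivative_works[symmetric])
      then show "pd [v] (\<lambda>x. w x + w' x) x = pd [v] w x + pd [v] w' x"
        by (subst pd_single_eqI) (auto simp: pd.simps)
    qed
    then show ?case
      using add.IH by (auto intro: alg_hull.intros)
  next
    case (mult w w')
    have "pd [v] (\<lambda>x. w x * w' x) = (\<lambda>x. w x * pd [v] w' x + pd [v] w x * w' x)" for v
    proof
      fix x
      have "((\<lambda>x. w x * w' x) has_derivative
          (\<lambda>v. w x * frechet_derivative w' (at x) v + frechet_derivative w (at x) v * w' x)) (at x)"
        using mult.IH by (intro has_derivative_mult) (auto simp: frechet_derivative_works[symmetric])
      then show "pd [v] (\<lambda>x. w x * w' x) x = w x * pd [v] w' x + pd [v] w x * w' x"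
        by (subst pd_single_eqI) (auto simp: pd.simps)
    qed
    then show ?case
      using mult by (simp add: alg_hull.add alg_hull.mult)
  qed
  show "w differentiable at x" if "w \<in> ?A" for w x
    using main[OF that] by blast
  show "pd [v] w \<in> ?A" if "w \<in> ?A" "v \<in> Basis" for w v
    using main[OF that(1)] that(2) by blast
qed

text \<open>With no extra generators, the coinduction says that the smooth functions form an
  algebra.\<close>

lemma smooth_fun_alg_hull: "w \<in> alg_hull (Collect smooth_fun) \<Longrightarrow> smooth_fun w"
  by (rule smooth_fun_coinduct_alg[where B = "{}"]) auto

lemma smooth_fun_const: "smooth_fun (\<lambda>x. c)"
  by (intro smooth_fun_alg_hull alg_hull.const)

lemma smooth_fun_add: "smooth_fun w \<Longrightarrow> smooth_fun w' \<Longrightarrow> smooth_fun (\<lambda>x. w x + w' x)"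
  by (intro smooth_fun_alg_hull alg_hull.add alg_hull.base) auto

lemma smooth_fun_mult: "smooth_fun w \<Longrightarrow> smooth_fun w' \<Longrightarrow> smooth_fun (\<lambda>x. w x * w' x)"
  by (intro smooth_fun_alg_hull alg_hull.mult alg_hull.base) auto

lemma smooth_fun_cmult: "smooth_fun w \<Longrightarrow> smooth_fun (\<lambda>x. c * w x)"
  by (intro smooth_fun_mult smooth_fun_const)

lemma smooth_fun_linear:
  fixes L :: "'a::euclidean_space \<Rightarrow> complex"
  assumes "bounded_linear L"
  shows "smooth_fun L"
proof (rule smooth_fun_coinduct_alg[where B = "{L}"])
  show "w differentiable at x" if "w \<in> {L}" for w x
    using assms that bounded_linear_imp_differentiable by blast
  show "pd [v] w \<in> alg_hull ({L} \<union> Collect smooth_fun)" if "w \<in> {L}" for w v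
  proof -
    have "pd [v] w = (\<lambda>x. L v)"
      using that assms by (auto simp: pd.simps frechet_derivative_at[OF bounded_linear_imp_has_derivative, symmetric])
    then show ?thesis by (simp add: alg_hull.const)
  qed
qed (auto intro: alg_hull.base)

section \<open>Smooth maps between Euclidean spaces and the chain rule\<close>

definition smooth_map :: "('a::euclidean_space \<Rightarrow> 'b::euclidean_space) \<Rightarrow> bool" where
  "smooth_map \<Phi> \<longleftrightarrow> (\<forall>i\<in>Basis. smooth_fun (\<lambda>x. complex_of_real (\<Phi> x \<bullet> i)))"

text \<open>Coordinates are embedded in the complex numbers in \<open>smooth_map\<close> because
  \<open>pd\<close> acts on complex-valued functions; \<open>Re\<close> undoes the
  embedding.\<close>

lemma smooth_map_has_derivative:
  assumes "smooth_map \<Phi>"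
  shows "(\<Phi> has_derivative
           (\<lambda>v. \<Sum>i\<in>Basis. Re (pd [v] (\<lambda>x. complex_of_real (\<Phi> x \<bullet> i)) x) *\<^sub>R i)) (at x)"
proof -
  have "((\<lambda>x. \<Phi> x \<bullet> i) has_derivative (\<lambda>v. Re (pd [v] (\<lambda>x. complex_of_real (\<Phi> x \<bullet> i)) x))) (at x)"
    if "i \<in> Basis" for i
    using has_derivative_Re[OF smooth_fun_has_derivative[of "\<lambda>x. complex_of_real (\<Phi> x \<bullet> i)" x]]
      assms that by (simp add: smooth_map_def)
  then have "((\<lambda>x. \<Sum>i\<in>Basis. (\<Phi> x \<bullet> i) *\<^sub>R i) has_derivative
           (\<lambda>v. \<Sum>i\<in>Basis. Re (pd [v] (\<lambda>x. complex_of_real (\<Phi> x \<bullet> i)) x) *\<^sub>R i)) (at x)"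
    by (intro has_derivative_sum has_derivative_scaleR_left)
  then show ?thesis
    by (simp only: euclidean_representation)
qed

text \<open>Taking the real part of a real function changes nothing, so uniqueness of the derivative
  shows that the derivative is real as well. This removes the \<open>Re\<close> that the chain rule
  brings in.\<close>

lemma pd_of_real_Re:
  assumes "smooth_fun (\<lambda>x. complex_of_real (g x))"
  shows "complex_of_real (Re (pd [v] (\<lambda>x. complex_of_real (g x)) x))
           = pd [v] (\<lambda>x. complex_of_real (g x)) x"
proof -
  note D = smooth_fun_has_derivative[OF assms]
  have "((\<lambda>x. complex_of_real (Re (complex_of_real (g x)))) has_derivative
      (\<lambda>v. complex_of_real (Re (pd [v] (\<lambda>x. complex_of_real (g x)) x)))) (at x)"
    by (intro has_derivative_of_real has_derivative_Re D)
  then have "((\<lambda>x. complex_of_real (g x)) has_derivative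
      (\<lambda>v. complex_of_real (Re (pd [v] (\<lambda>x. complex_of_real (g x)) x)))) (at x)"
    by simp
  from has_derivative_unique[OF this D] show ?thesis by metis
qed

text \<open>The generators are all compositions of smooth functions with \<open>\<Phi>\<close>. By
  the chain rule a derivative is a sum of products of derivatives of the coordinates of
  \<open>\<Phi>\<close>, which are smooth, with further generators.\<close>

lemma smooth_fun_compose:
  fixes \<Phi> :: "'a::euclidean_space \<Rightarrow> 'b::euclidean_space"
  assumes w: "smooth_fun w" and \<Phi>: "smooth_map \<Phi>"
  shows "smooth_fun (\<lambda>x. w (\<Phi> x))"
proof (rule smooth_fun_coinduct_alg[where B = "{\<lambda>x. w (\<Phi> x) | w. smooth_fun w}"])
  let ?B = "{\<lambda>x. w (\<Phi> x) | w. smooth_fun w}"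
  have D: "((\<lambda>x. w (\<Phi> x)) has_derivative
      (\<lambda>v. \<Sum>i\<in>Basis. pd [v] (\<lambda>x. complex_of_real (\<Phi> x \<bullet> i)) x * pd [i] w (\<Phi> x))) (at x)"
    if w: "smooth_fun w" for w x
  proof -
    note Dw = smooth_fun_has_derivative[OF w, of "\<Phi> x"]
    have L: "linear (\<lambda>v. pd [v] w (\<Phi> x))"
      using Dw has_derivative_linear by blast
    have lin: "pd [\<Sum>i\<in>Basis. a i *\<^sub>R i] w (\<Phi> x) = (\<Sum>i\<in>Basis. a i *\<^sub>R pd [i] w (\<Phi> x))" for a
      using linear_sum[OF L, of "\<lambda>i. a i *\<^sub>R i" Basis] linear_cmul[OF L]
      by simp
    from has_derivative_compose[OF smooth_map_has_derivative[OF \<Phi>] Dw]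
    have "((\<lambda>x. w (\<Phi> x)) has_derivative (\<lambda>v. \<Sum>i\<in>Basis.
        complex_of_real (Re (pd [v] (\<lambda>x. complex_of_real (\<Phi> x \<bullet> i)) x)) * pd [i] w (\<Phi> x))) (at x)"
      unfolding lin by (simp add: scaleR_conv_of_real)
    moreover have "complex_of_real (Re (pd [v] (\<lambda>x. complex_of_real (\<Phi> x \<bullet> i)) x))
           = pd [v] (\<lambda>x. complex_of_real (\<Phi> x \<bullet> i)) x" if "i \<in> Basis" for i v
      using \<Phi> that by (intro pd_of_real_Re) (auto simp: smooth_map_def)
    ultimately show ?thesis by simp
  qed
  show "u differentiable at x" if "u \<in> ?B" for u x
    using that D differentiableI by blast
  show "pd [v] u \<in> alg_hull (?B \<union> Collect smooth_fun)" if u: "u \<in> ?B" and v: "v \<in> Basis" for u v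
  proof -
    obtain w where w: "u = (\<lambda>x. w (\<Phi> x))" "smooth_fun w" using u by blast
    have eq: "pd [v] u = (\<lambda>x. \<Sum>i\<in>Basis. pd [v] (\<lambda>x. complex_of_real (\<Phi> x \<bullet> i)) x * pd [i] w (\<Phi> x))"
      unfolding w(1) by (rule ext) (rule pd_single_eqI[OF D[OF w(2)]])
    show ?thesis
      unfolding eq
    proof (intro alg_hull_sum alg_hull.mult alg_hull.base)
      fix i :: 'b assume i: "i \<in> Basis"
      show "pd [v] (\<lambda>x. complex_of_real (\<Phi> x \<bullet> i)) \<in> ?B \<union> Collect smooth_fun"
        using \<Phi> i v smooth_fun_pd[of _ "[v]"] by (simp add: smooth_map_def)
      show "(\<lambda>x. pd [i] w (\<Phi> x)) \<in> ?B \<union> Collect smooth_fun"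
        using smooth_fun_pd[OF w(2), of "[i]"] i by auto
    qed
  qed
qed (use w in \<open>auto intro: alg_hull.base\<close>)

lemma smooth_map_compose:
  "smooth_map \<Psi> \<Longrightarrow> smooth_map \<Phi> \<Longrightarrow> smooth_map (\<lambda>x. \<Psi> (\<Phi> x))"
  using smooth_fun_compose[of "\<lambda>y. complex_of_real (\<Psi> y \<bullet> i)" \<Phi> for i]
  by (simp add: smooth_map_def)

lemma smooth_map_linear:
  assumes "bounded_linear L"
  shows "smooth_map L"
  unfolding smooth_map_def
  by (intro ballI smooth_fun_linear assms
      bounded_linear_compose[OF bounded_linear_of_real bounded_linear_inner_left_comp])

lemma smooth_map_add: "smooth_map \<Phi> \<Longrightarrow> smooth_map \<Psi> \<Longrightarrow> smooth_map (\<lambda>x. \<Phi> x + \<Psi> x)"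
  by (simp add: smooth_map_def inner_add_left smooth_fun_add)

lemma smooth_map_Pair: "smooth_map \<Phi> \<Longrightarrow> smooth_map \<Psi> \<Longrightarrow> smooth_map (\<lambda>x. (\<Phi> x, \<Psi> x))"
  by (auto simp: smooth_map_def Basis_prod_def)

lemma smooth_map_const: "smooth_map (\<lambda>x. c)"
  by (simp add: smooth_map_def smooth_fun_const)

lemma smooth_fun_of_real_iff: "smooth_fun (\<lambda>x. complex_of_real (g x)) \<longleftrightarrow> smooth_map g"
  by (simp add: smooth_map_def)

text \<open>The derivative \<open>1 - tanh x ^ 2\<close> is a polynomial in \<open>tanh\<close>, so
  a single generator suffices.\<close>

lemma smooth_map_tanh: "smooth_map (tanh :: real \<Rightarrow> real)"
proof -
  let ?T = "\<lambda>x::real. complex_of_real (tanh x)"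
  have D: "(?T has_derivative (\<lambda>v. complex_of_real (v * (1 - tanh x ^ 2)))) (at x)" for x
    using has_field_derivative_tanh[OF _ DERIV_ident, of x]
    by (intro has_derivative_of_real) (simp add: has_field_derivative_def mult_commute_abs)
  have "smooth_fun ?T"
  proof (rule smooth_fun_coinduct_alg[where B = "{?T}"])
    show "w differentiable at x" if "w \<in> {?T}" for w x
      using D that differentiableI by blast
    fix w and v :: real assume "w \<in> {?T}" "v \<in> Basis"
    then have eq: "pd [v] w = (\<lambda>x. 1 + (-1) * (?T x * ?T x))"
      using pd_single_eqI[OF D, of v] by (auto simp: power2_eq_square)
    show "pd [v] w \<in> alg_hull ({?T} \<union> Collect smooth_fun)"
      unfolding eq by (intro alg_hull.add alg_hull.mult alg_hull.const alg_hull.base) auto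
  qed (auto intro: alg_hull.base)
  then show ?thesis
    by (simp add: smooth_fun_of_real_iff)
qed

text \<open>Differentiation swaps \<open>cosh\<close> and \<open>sinh\<close>. The function is
  needed because \<open>(cosh s)\<^sup>2\<close> is the reciprocal of the derivative of
  \<open>tanh\<close>.\<close>

lemma smooth_map_cosh: "smooth_map (cosh :: real \<Rightarrow> real)"
proof -
  let ?C = "\<lambda>x::real. complex_of_real (cosh x)" and ?S = "\<lambda>x::real. complex_of_real (sinh x)"
  have DC: "(?C has_derivative (\<lambda>v. complex_of_real (v * sinh x))) (at x)" for x
    by (intro has_derivative_of_real) (auto simp: mult.commute intro!: derivative_eq_intros)
  have DS: "(?S has_derivative (\<lambda>v. complex_of_real (v * cosh x))) (at x)" for x
    by (intro has_derivative_of_real) (auto simp: mult.commute intro!: derivative_eq_intros)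
  have "smooth_fun ?C"
  proof (rule smooth_fun_coinduct_alg[where B = "{?C, ?S}"])
    show "w differentiable at x" if "w \<in> {?C, ?S}" for w x
      using DC DS that differentiableI by blast
    fix w and v :: real assume "w \<in> {?C, ?S}" "v \<in> Basis"
    then have "pd [v] w \<in> {?C, ?S}"
      using pd_single_eqI[OF DC, of v] pd_single_eqI[OF DS, of v] by auto
    then show "pd [v] w \<in> alg_hull ({?C, ?S} \<union> Collect smooth_fun)"
      by (auto intro: alg_hull.base)
  qed (auto intro: alg_hull.base)
  then show ?thesis
    by (simp add: smooth_fun_of_real_iff)
qed

subsection \<open>Smooth curves and symmetry of mixed derivatives\<close>

lemma smooth_fun_has_vector_derivative:
  fixes g :: "real \<Rightarrow> complex"
  assumes "smooth_fun g"
  shows "(g has_vector_derivative pd [1] g t) (at t)"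
proof -
  note D = smooth_fun_has_derivative[OF assms, of t]
  have eq: "(\<lambda>r. pd [r] g t) = (\<lambda>r. r *\<^sub>R pd [1] g t)"
  proof
    fix r
    have "pd [r *\<^sub>R 1] g t = r *\<^sub>R pd [1] g t"
      by (rule linear_cmul[OF has_derivative_linear[OF D]])
    then show "pd [r] g t = r *\<^sub>R pd [1] g t"
      by (simp only: real_scaleR_def mult_1_right)
  qed
  show ?thesis
    unfolding has_vector_derivative_def eq[symmetric] by (rule D)
qed

text \<open>The only basis vector of the line is 1. Hence a sequence \<open>d\<close> of successive
  derivatives is itself an invariant family, and conversely the iterates of \<open>pd [1]\<close>
  form such a sequence.\<close>

lemma smooth_curve_iff_smooth_fun:
  fixes g :: "real \<Rightarrow> complex"
  shows "smooth_curve g \<longleftrightarrow> smooth_fun g"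
proof
  assume "smooth_curve g"
  then obtain d where d: "d 0 = g" "\<And>k t. (d k has_vector_derivative d (Suc k) t) (at t)"
    unfolding smooth_curve_def by blast
  show "smooth_fun g"
  proof (rule smooth_fun_coinduct[where F = "range d"])
    show "g \<in> range d" using d(1) by blast
    show "w differentiable at x" if "w \<in> range d" for w x
      using d(2) that unfolding has_vector_derivative_def differentiable_def by blast
    fix w and v :: real assume "w \<in> range d" "v \<in> Basis"
    then obtain k where "w = d k" "v = 1" by auto
    then have "pd [v] w = d (Suc k)"
      using pd_single_eqI[OF d(2)[unfolded has_vector_derivative_def]]
      by auto
    then show "pd [v] w \<in> range d" by blast
  qed
next
  assume g: "smooth_fun g"
  have "(pd (replicate k 1) g has_vector_derivative pd (replicate (Suc k) 1) g t) (at t)" for k t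
    using smooth_fun_has_vector_derivative[OF smooth_fun_pd[OF g, of "replicate k 1"]]
    by (simp add: set_replicate_conv_if pd_Cons[of _ "replicate k 1"])
  then show "smooth_curve g"
    unfolding smooth_curve_def by (intro exI[of _ "\<lambda>k. pd (replicate k 1) g"]) auto
qed

lemma smooth_curve_iff_smooth_map:
  fixes c :: "real \<Rightarrow> 'a::euclidean_space"
  shows "smooth_curve c \<longleftrightarrow> smooth_map c"
proof
  assume "smooth_curve c"
  then obtain d where d: "d 0 = c" "\<And>k t. (d k has_vector_derivative d (Suc k) t) (at t)"
    unfolding smooth_curve_def by blast
  show "smooth_map c"
    unfolding smooth_map_def
  proof
    fix i :: 'a
    have "((\<lambda>t. complex_of_real (d k t \<bullet> i)) has_vector_derivative
        complex_of_real (d (Suc k) t \<bullet> i)) (at t)" for k t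
      by (intro bounded_linear.has_vector_derivative[OF bounded_linear_of_real]
          bounded_linear.has_vector_derivative[OF bounded_linear_inner_left] d(2))
    then have "smooth_curve (\<lambda>t. complex_of_real (c t \<bullet> i))"
      unfolding smooth_curve_def
      by (intro exI[of _ "\<lambda>k t. complex_of_real (d k t \<bullet> i)"]) (auto simp: d(1))
    then show "smooth_fun (\<lambda>t. complex_of_real (c t \<bullet> i))"
      by (simp add: smooth_curve_iff_smooth_fun)
  qed
next
  assume c: "smooth_map c"
  define e where "e k i = pd (replicate k 1) (\<lambda>t. complex_of_real (c t \<bullet> i))" for k i
  have "((\<lambda>t. \<Sum>i\<in>Basis. Re (e k i t) *\<^sub>R i) has_vector_derivative
      (\<Sum>i\<in>Basis. Re (e (Suc k) i t) *\<^sub>R i)) (at t)" for k t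
  proof (rule has_vector_derivative_sum)
    fix i :: 'a assume "i \<in> Basis"
    then have "smooth_fun (e k i)"
      using c unfolding e_def smooth_map_def by (intro smooth_fun_pd) auto
    then have "(e k i has_vector_derivative e (Suc k) i t) (at t)"
      using smooth_fun_has_vector_derivative by (fastforce simp: e_def pd_Cons[of _ "replicate k 1"])
    then show "((\<lambda>t. Re (e k i t) *\<^sub>R i) has_vector_derivative Re (e (Suc k) i t) *\<^sub>R i) (at t)"
      by (intro bounded_linear.has_vector_derivative[OF bounded_linear_scaleR_left]
          bounded_linear.has_vector_derivative[OF bounded_linear_Re])
  qed
  moreover have "(\<lambda>t. \<Sum>i\<in>Basis. Re (e 0 i t) *\<^sub>R i) = c"
    by (simp add: e_def euclidean_representation)
  ultimately show "smooth_curve c"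
    unfolding smooth_curve_def
    by (intro exI[of _ "\<lambda>k t. \<Sum>i\<in>Basis. Re (e k i t) *\<^sub>R i"]) auto
qed

section \<open>Localisation in time by the hyperbolic tangent\<close>

lemma tanh_artanh_real:
  fixes y :: real
  assumes "\<bar>y\<bar> < 1"
  shows "tanh (artanh y) = y"
proof -
  have "exp (- 2 * artanh y) = (1 - y) / (1 + y)"
    using assms by (simp add: artanh_def exp_minus divide_simps abs_if split: if_splits)
  then have "exp (- 2 * artanh y) * (1 + y) = 1 - y"
    using assms by auto
  moreover have "1 + exp (- 2 * artanh y) \<noteq> 0"
    using exp_gt_zero[of "- 2 * artanh y"] by linarith
  ultimately show ?thesis
    unfolding tanh_real_altdef by (simp add: nonzero_divide_eq_eq algebra_simps)
qed

text \<open>Near \<open>t0\<close> the map \<open>s \<mapsto> t0 + \<delta> tanh s\<close> is a diffeomorphism onto a neighbourhood of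
  \<open>t0\<close>; it replaces a cut-off function, because it turns a curve that is only well behaved
  near \<open>t0\<close> into one that is well behaved on the whole line.\<close>

lemma smooth_fun_tanh_local:
  fixes g :: "real \<Rightarrow> complex"
  assumes "\<And>t0. \<exists>\<delta>>0. smooth_fun (\<lambda>s. g (t0 + \<delta> * tanh s))"
  shows "smooth_fun g"
proof (rule smooth_fun_coinduct)
  \<comment> \<open>The hypothesis itself is taken as the invariant family: being locally smooth
    after the substitution must pass to the derivative.\<close>
  define F :: "(real \<Rightarrow> complex) set"
    where "F = {g. \<forall>t0. \<exists>\<delta>>0. smooth_fun (\<lambda>s. g (t0 + \<delta> * tanh s))}"
  have F_D: "\<exists>\<delta>>0. smooth_fun (\<lambda>s. w (t0 + \<delta> * tanh s))" if "w \<in> F" for w t0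
    using that unfolding F_def mem_Collect_eq by (rule spec)
  show "g \<in> F" unfolding F_def mem_Collect_eq using assms by (rule allI)
  show diff: "w differentiable at t0" if wF: "w \<in> F" for w t0
  proof -
    obtain \<delta> where \<delta>: "\<delta> > 0" "smooth_fun (\<lambda>s. w (t0 + \<delta> * tanh s))"
      using F_D[OF wF] by metis
    define G where "G s = w (t0 + \<delta> * tanh s)" for s
    \<comment> \<open>Near \<open>t0\<close> the function is recovered from its pullback
      \<open>G\<close> by the inverse substitution. Differentiability is only required at the centre
      \<open>t0\<close>, where the argument of \<open>artanh\<close> is 0.\<close>
    have "(artanh has_field_derivative 1) (at ((t0 - t0) / \<delta>))"
      using artanh_real_has_field_derivative[of 0 UNIV] by simp
    moreover have "((\<lambda>t. (t - t0) / \<delta>) has_field_derivative 1 / \<delta>) (at t0)"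
      using \<delta>(1) by (auto intro!: derivative_eq_intros)
    ultimately have "((\<lambda>t. artanh ((t - t0) / \<delta>)) has_field_derivative 1 * (1 / \<delta>)) (at t0)"
      by (rule DERIV_chain2)
    then have "((\<lambda>t. artanh ((t - t0) / \<delta>)) has_derivative (*) (1 / \<delta>)) (at t0)"
      by (simp add: has_field_derivative_def)
    from has_derivative_compose[OF this smooth_fun_has_derivative[OF \<delta>(2)[folded G_def]]]
    have D: "((\<lambda>t. G (artanh ((t - t0) / \<delta>))) has_derivative
        (\<lambda>h. pd [1 / \<delta> * h] G (artanh ((t0 - t0) / \<delta>)))) (at t0)" .
    show ?thesis
    proof (rule differentiableI, rule has_derivative_transform_within_open[OF D, where s = "ball t0 \<delta>"])
      fix t assume "t \<in> ball t0 \<delta>"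
      then have "\<bar>(t - t0) / \<delta>\<bar> < 1" using \<delta>(1) by (simp add: dist_real_def abs_minus_commute)
      then show "G (artanh ((t - t0) / \<delta>)) = w t"
        using \<delta>(1) by (simp add: G_def tanh_artanh_real)
    qed (use \<delta> in auto)
  qed
  fix w and v :: real assume w: "w \<in> F" and "v \<in> Basis"
  then have v: "v = 1" by simp
  show "pd [v] w \<in> F"
    unfolding F_def mem_Collect_eq
  proof
    fix t0
    obtain \<delta> where \<delta>: "\<delta> > 0" "smooth_fun (\<lambda>s. w (t0 + \<delta> * tanh s))"
      using F_D[OF w] by metis
    define G where "G s = w (t0 + \<delta> * tanh s)" for s
    have G: "smooth_fun G" using \<delta> by (simp add: G_def[abs_def])
    \<comment> \<open>The pullback of the derivative is the derivative of the pullback divided by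
      \<open>\<delta> / (cosh s)\<^sup>2\<close>. This quotient is smooth on the whole line, so the
      same \<open>\<delta>\<close> works again.\<close>
    have "pd [1] w (t0 + \<delta> * tanh s)
        = complex_of_real (1 / \<delta>) * (complex_of_real (cosh s) * (complex_of_real (cosh s) * pd [1] G s))" for s
    proof -
      have "1 - (tanh s)\<^sup>2 = 1 / (cosh s)\<^sup>2"
        using hyperbolic_pythagoras[of s] by (simp add: tanh_def power_divide diff_divide_eq_iff)
      then have dr: "((\<lambda>s. t0 + \<delta> * tanh s) has_derivative (*) (\<delta> / (cosh s)\<^sup>2)) (at s)"
        unfolding has_field_derivative_def[symmetric]
        by (auto intro!: derivative_eq_intros)
      note dw = diff[OF w, of "t0 + \<delta> * tanh s", unfolded frechet_derivative_works]
      from has_derivative_compose[OF dr dw]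
      have "pd [1] G s = frechet_derivative w (at (t0 + \<delta> * tanh s)) ((\<delta> / (cosh s)\<^sup>2) *\<^sub>R 1)"
        unfolding G_def by (subst pd_single_eqI, assumption) simp
      also have "\<dots> = (\<delta> / (cosh s)\<^sup>2) *\<^sub>R pd [1] w (t0 + \<delta> * tanh s)"
        by (subst linear_cmul[OF has_derivative_linear[OF dw]]) (simp add: pd.simps)
      finally show ?thesis
        using \<delta>(1) by (simp add: scaleR_conv_of_real power2_eq_square)
    qed
    moreover have "smooth_fun (\<lambda>s. complex_of_real (1 / \<delta>) *
        (complex_of_real (cosh s) * (complex_of_real (cosh s) * pd [1] G s)))"
      using smooth_map_cosh smooth_fun_pd[OF G, of "[1]"]
      by (intro smooth_fun_cmult smooth_fun_mult) (auto simp: smooth_fun_of_real_iff)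
    ultimately show "\<exists>\<delta>>0. smooth_fun (\<lambda>s. pd [v] w (t0 + \<delta> * tanh s))"
      using \<delta>(1) unfolding v by (intro exI[of _ \<delta>]) simp
  qed
qed

section \<open>Symmetry of mixed partial derivatives\<close>

lemma smooth_fun_continuous_on: "smooth_fun w \<Longrightarrow> continuous_on S w"
  by (meson continuous_at_imp_continuous_on differentiable_imp_continuous_within smooth_fun_differentiable)

lemma smooth_fun_line_derivative:
  assumes "smooth_fun w"
  shows "((\<lambda>r. w (x + r *\<^sub>R v)) has_vector_derivative pd [v] w (x + r *\<^sub>R v)) (at r within S)"
proof -
  note D = smooth_fun_has_derivative[OF assms, of "x + r *\<^sub>R v"]
  have "((\<lambda>r. x + r *\<^sub>R v) has_derivative (\<lambda>h. h *\<^sub>R v)) (at r within S)"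
    by (auto intro!: derivative_eq_intros)
  from has_derivative_compose[OF this D]
  show ?thesis
    using linear_cmul[OF has_derivative_linear[OF D]]
    by (simp add: has_vector_derivative_def)
qed

text \<open>The second difference is symmetric in \<open>u\<close> and \<open>v\<close>, so this estimate identifies both
  mixed derivatives.\<close>

lemma second_difference_approx:
  assumes w: "smooth_fun w" and v: "v \<in> Basis" and u: "u \<in> Basis" and e: "e > 0"
  shows "\<exists>\<delta>>0. \<forall>s. 0 < s \<and> s < \<delta> \<longrightarrow>
    norm (w (x + s *\<^sub>R v + s *\<^sub>R u) - w (x + s *\<^sub>R v) - w (x + s *\<^sub>R u) + w x
      - s\<^sup>2 *\<^sub>R pd [u] (pd [v] w) x) \<le> e * s\<^sup>2"
proof -
  let ?a = "pd [u] (pd [v] w)"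
  have wv: "smooth_fun (pd [v] w)" using smooth_fun_pd[OF w, of "[v]"] v by simp
  have wvu: "smooth_fun ?a" using smooth_fun_pd[OF wv, of "[u]"] u by simp
  have "isCont ?a x"
    using smooth_fun_continuous_on[OF wvu, of UNIV] by (simp add: continuous_on_eq_continuous_at)
  then obtain \<delta> where \<delta>: "\<delta> > 0" "\<And>y. dist y x < \<delta> \<Longrightarrow> dist (?a y) (?a x) < e"
    using e unfolding continuous_at_eps_delta by blast
  \<comment> \<open>The threshold is halved because steps of length at most \<open>s\<close> along
    \<open>v\<close> and along \<open>u\<close> add up to at most \<open>2 * s\<close>.\<close>
  have "norm (w (x + s *\<^sub>R v + s *\<^sub>R u) - w (x + s *\<^sub>R v) - w (x + s *\<^sub>R u) + w x
      - s\<^sup>2 *\<^sub>R ?a x) \<le> e * s\<^sup>2" if s: "0 < s" "s < \<delta> / 2" for s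
  proof -
    have near: "norm (?a (x + r *\<^sub>R v + q *\<^sub>R u) - ?a x) \<le> e" if "r \<in> {0..s}" "q \<in> {0..s}" for r q
    proof -
      have "norm (r *\<^sub>R v + q *\<^sub>R u) \<le> r + q"
        using norm_triangle_ineq[of "r *\<^sub>R v" "q *\<^sub>R u"] that u v by simp
      then have "dist (x + r *\<^sub>R v + q *\<^sub>R u) x < \<delta>"
        using that s by (simp add: dist_norm add.assoc)
      from \<delta>(2)[OF this] show ?thesis by (simp add: dist_norm)
    qed
    \<comment> \<open>Mean value inequality along \<open>u\<close>, applied to
      \<open>pd [v] w\<close> minus its expected linear part; by \<open>near\<close> the remaining
      derivative is at most \<open>e\<close>.\<close>
    have inner: "norm (pd [v] w (x + r *\<^sub>R v + s *\<^sub>R u) - pd [v] w (x + r *\<^sub>R v) - s *\<^sub>R ?a x) \<le> s * e"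
      if r: "r \<in> {0..s}" for r
    proof -
      define f where "f q = pd [v] w (x + r *\<^sub>R v + q *\<^sub>R u) - q *\<^sub>R ?a x" for q
      have "norm (f s - f 0) \<le> e * norm (s - 0)"
      proof (rule differentiable_bound[where S = "{0..s}" and f' = "\<lambda>q h. h *\<^sub>R (?a (x + r *\<^sub>R v + q *\<^sub>R u) - ?a x)"])
        fix q assume q: "q \<in> {0..s}"
        have "(f has_vector_derivative (?a (x + r *\<^sub>R v + q *\<^sub>R u) - 1 *\<^sub>R ?a x)) (at q within {0..s})"
          unfolding f_def
          by (intro has_vector_derivative_diff smooth_fun_line_derivative wv
              bounded_linear.has_vector_derivative[OF bounded_linear_scaleR_left] has_vector_derivative_id)
        then show "(f has_derivative (\<lambda>h. h *\<^sub>R (?a (x + r *\<^sub>R v + q *\<^sub>R u) - ?a x))) (at q within {0..s})"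
          by (simp add: has_vector_derivative_def)
        show "onorm (\<lambda>h. h *\<^sub>R (?a (x + r *\<^sub>R v + q *\<^sub>R u) - ?a x)) \<le> e"
          using near[OF r q] by (intro onorm_le) (simp add: mult.commute[of e] mult.commute[of "s * e"] mult_left_mono)
      qed (use s in auto)
      moreover have "f s - f 0 = pd [v] w (x + r *\<^sub>R v + s *\<^sub>R u) - pd [v] w (x + r *\<^sub>R v) - s *\<^sub>R ?a x"
        by (simp add: f_def)
      ultimately show ?thesis using s by (simp add: mult.commute[of s e])
    qed
    \<comment> \<open>A second mean value inequality, now along \<open>v\<close>: the derivative of
      \<open>g\<close> is the quantity bounded in \<open>inner\<close>, and the increment of
      \<open>g\<close> is the second difference minus its main term.\<close>
    define g where "g r = w (x + s *\<^sub>R u + r *\<^sub>R v) - w (x + r *\<^sub>R v) - r *\<^sub>R (s *\<^sub>R ?a x)" for r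
    let ?g' = "\<lambda>r. pd [v] w (x + s *\<^sub>R u + r *\<^sub>R v) - pd [v] w (x + r *\<^sub>R v) - s *\<^sub>R ?a x"
    have "norm (g s - g 0) \<le> (s * e) * norm (s - 0)"
    proof (rule differentiable_bound[where S = "{0..s}" and f' = "\<lambda>r h. h *\<^sub>R ?g' r"])
      fix r assume r: "r \<in> {0..s}"
      have "(g has_vector_derivative (pd [v] w (x + s *\<^sub>R u + r *\<^sub>R v) - pd [v] w (x + r *\<^sub>R v) - 1 *\<^sub>R (s *\<^sub>R ?a x)))
          (at r within {0..s})"
        unfolding g_def
        by (intro has_vector_derivative_diff smooth_fun_line_derivative w
            bounded_linear.has_vector_derivative[OF bounded_linear_scaleR_left] has_vector_derivative_id)
      then show "(g has_derivative (\<lambda>h. h *\<^sub>R ?g' r)) (at r within {0..s})"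
        by (simp add: has_vector_derivative_def)
      have "norm (?g' r) \<le> s * e"
        using inner[OF r] by (simp add: add_ac)
      then show "onorm (\<lambda>h. h *\<^sub>R ?g' r) \<le> s * e"
        by (intro onorm_le) (simp add: mult.commute[of e] mult.commute[of "s * e"] mult_left_mono)
    qed (use s in auto)
    moreover have wcomm: "w (x + s *\<^sub>R u + s *\<^sub>R v) = w (x + s *\<^sub>R v + s *\<^sub>R u)"
      by (simp add: add_ac)
    have "g s - g 0 = w (x + s *\<^sub>R v + s *\<^sub>R u) - w (x + s *\<^sub>R v) - w (x + s *\<^sub>R u) + w x
        - s\<^sup>2 *\<^sub>R ?a x"
      by (simp add: g_def power2_eq_square wcomm)
    ultimately show ?thesis
      using s by (simp add: power2_eq_square mult_ac)
  qed
  then show ?thesis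
    using \<delta>(1) half_gt_zero by blast
qed

lemma pd_commute:
  assumes w: "smooth_fun w" and v: "v \<in> Basis" and u: "u \<in> Basis"
  shows "pd [u] (pd [v] w) = pd [v] (pd [u] w)"
proof
  fix x
  let ?a = "pd [u] (pd [v] w) x" and ?b = "pd [v] (pd [u] w) x"
  have "norm (?a - ?b) \<le> 2 * e" if e: "e > 0" for e
  proof -
    define \<Delta> where "\<Delta> s = w (x + s *\<^sub>R v + s *\<^sub>R u) - w (x + s *\<^sub>R v) - w (x + s *\<^sub>R u) + w x" for s
    obtain \<delta>1 where \<delta>1: "\<delta>1 > 0" "\<And>s. 0 < s \<Longrightarrow> s < \<delta>1 \<Longrightarrow> norm (\<Delta> s - s\<^sup>2 *\<^sub>R ?a) \<le> e * s\<^sup>2"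
      using second_difference_approx[OF w v u e, of x] unfolding \<Delta>_def by blast
    obtain \<delta>2 where \<delta>2: "\<delta>2 > 0" "\<And>s. 0 < s \<Longrightarrow> s < \<delta>2 \<Longrightarrow> norm (\<Delta> s - s\<^sup>2 *\<^sub>R ?b) \<le> e * s\<^sup>2"
    proof -
      have "w (x + s *\<^sub>R u + s *\<^sub>R v) - w (x + s *\<^sub>R u) - w (x + s *\<^sub>R v) + w x = \<Delta> s" for s
        by (simp add: \<Delta>_def algebra_simps)
      then show ?thesis
        using second_difference_approx[OF w u v e, of x] that by auto
    qed
    define s where "s = min \<delta>1 \<delta>2 / 2"
    have s: "0 < s" "s < \<delta>1" "s < \<delta>2" using \<delta>1(1) \<delta>2(1) by (auto simp: s_def)
    have "norm ((\<Delta> s - s\<^sup>2 *\<^sub>R ?b) - (\<Delta> s - s\<^sup>2 *\<^sub>R ?a)) \<le> e * s\<^sup>2 + e * s\<^sup>2"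
      using norm_triangle_le_diff[OF add_mono[OF \<delta>2(2)[OF s(1,3)] \<delta>1(2)[OF s(1,2)]]] by simp
    moreover have "(\<Delta> s - s\<^sup>2 *\<^sub>R ?b) - (\<Delta> s - s\<^sup>2 *\<^sub>R ?a) = s\<^sup>2 *\<^sub>R (?a - ?b)"
      by (simp add: algebra_simps)
    ultimately have "s\<^sup>2 * norm (?a - ?b) \<le> s\<^sup>2 * (2 * e)"
      by (simp add: mult_ac)
    then show ?thesis using s(1) by simp
  qed
  \<comment> \<open>For this \<open>e\<close> the estimate bounds the norm by half of
    itself.\<close>
  from this[of "norm (?a - ?b) / 4"] show "?a = ?b"
    by (cases "norm (?a - ?b) > 0") auto
qed

text \<open>This is used to move the time derivative past spatial derivatives of a jointly smooth
  function.\<close>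

lemma pd_commute_list:
  assumes "smooth_fun w" "v \<in> Basis" "set us \<subseteq> Basis"
  shows "pd us (pd [v] w) = pd [v] (pd us w)"
  using assms(3)
proof (induction us)
  case (Cons u us)
  have "pd (u # us) (pd [v] w) = pd [u] (pd us (pd [v] w))" by (rule pd_Cons)
  also have "\<dots> = pd [u] (pd [v] (pd us w))"
    using Cons by simp
  also have "\<dots> = pd [v] (pd [u] (pd us w))"
    using Cons.prems assms(1,2) by (intro pd_commute smooth_fun_pd) auto
  finally show ?case by (simp add: pd_Cons[of u us])
qed simp

subsection \<open>Test functions and seminorms\<close>

lemma pd_add:
  assumes "smooth_fun \<phi>" "smooth_fun \<psi>" "set vs \<subseteq> Basis"
  shows "pd vs (\<lambda>x. \<phi> x + \<psi> x) = (\<lambda>x. pd vs \<phi> x + pd vs \<psi> x)"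
  using assms(3)
proof (induction vs)
  case (Cons v vs)
  have "smooth_fun (pd vs \<phi>)" "smooth_fun (pd vs \<psi>)"
    using Cons.prems assms by (auto intro: smooth_fun_pd)
  note D = has_derivative_add[OF this[THEN smooth_fun_has_derivative]]
  have "pd [v] (\<lambda>x. pd vs \<phi> x + pd vs \<psi> x) = (\<lambda>x. pd [v] (pd vs \<phi>) x + pd [v] (pd vs \<psi>) x)"
    by (rule ext) (rule pd_single_eqI[OF D])
  then show ?case
    using Cons by (simp add: pd_Cons[of v vs])
qed simp

lemma pd_cmult:
  assumes "smooth_fun \<phi>" "set vs \<subseteq> Basis"
  shows "pd vs (\<lambda>x. c * \<phi> x) = (\<lambda>x. c * pd vs \<phi> x)"
  using assms(2)
proof (induction vs)
  case (Cons v vs)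
  have "smooth_fun (pd vs \<phi>)"
    using Cons.prems assms by (auto intro: smooth_fun_pd)
  note D = has_derivative_mult_right[OF this[THEN smooth_fun_has_derivative]]
  have "pd [v] (\<lambda>x. c * pd vs \<phi> x) = (\<lambda>x. c * pd [v] (pd vs \<phi>) x)"
    by (rule ext) (rule pd_single_eqI[OF D])
  then show ?case
    using Cons by (simp add: pd_Cons[of v vs])
qed simp

text \<open>The complement of \<open>K\<close> is open, so vanishing there is a local property
  inherited by each derivative.\<close>

lemma pd_eq_0_outside_closed:
  assumes "closed K" "\<And>x. x \<notin> K \<Longrightarrow> \<phi> x = 0" "x \<notin> K"
  shows "pd vs \<phi> x = 0"
  using assms(3)
proof (induction vs arbitrary: x)
  case (Cons v vs)
  have "(pd vs \<phi> has_derivative (\<lambda>h. 0)) (at x)"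
    using Cons assms(1)
    by (intro has_derivative_transform_within_open[OF has_derivative_const[of 0], where s = "- K"]) auto
  from pd_single_eqI[OF this] show ?case
    by (simp add: pd_Cons[of v vs])
qed (use assms in simp)

lemma tsupp_subset_iff: "closed K \<Longrightarrow> tsupp \<phi> \<subseteq> K \<longleftrightarrow> (\<forall>x. x \<notin> K \<longrightarrow> \<phi> x = 0)"
  unfolding tsupp_def using closure_minimal[of "{x. \<phi> x \<noteq> 0}" K] closure_subset[of "{x. \<phi> x \<noteq> 0}"]
  by blast

lemma not_in_tsupp: "x \<notin> tsupp \<phi> \<Longrightarrow> \<phi> x = 0"
  unfolding tsupp_def using closure_subset[of "{x. \<phi> x \<noteq> 0}"] by blast

lemma testfnsI:
  assumes "smooth_fun \<phi>" "compact K" "K \<subseteq> \<Omega>" "\<And>x. x \<notin> K \<Longrightarrow> \<phi> x = 0"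
  shows "\<phi> \<in> testfns \<Omega>" "tsupp \<phi> \<subseteq> K"
proof -
  show sub: "tsupp \<phi> \<subseteq> K"
    using assms by (simp add: tsupp_subset_iff compact_imp_closed)
  then have "compact (tsupp \<phi>)"
    using assms(2) compact_Int_closed[of K "tsupp \<phi>"] by (simp add: tsupp_def Int_absorb1)
  then show "\<phi> \<in> testfns \<Omega>"
    using assms sub unfolding testfns_def by blast
qed

lemma testfns_smooth: "\<phi> \<in> testfns \<Omega> \<Longrightarrow> smooth_fun \<phi>"
  by (simp add: testfns_def)

lemma testfns_add:
  assumes "\<phi> \<in> testfns \<Omega>" "\<psi> \<in> testfns \<Omega>"
  shows "(\<lambda>x. \<phi> x + \<psi> x) \<in> testfns \<Omega>"
proof (rule testfnsI(1)[where K = "tsupp \<phi> \<union> tsupp \<psi>"])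
  show "smooth_fun (\<lambda>x. \<phi> x + \<psi> x)"
    using assms by (intro smooth_fun_add testfns_smooth)
qed (use assms in \<open>auto simp: testfns_def not_in_tsupp\<close>)

lemma testfns_cmult:
  assumes "\<phi> \<in> testfns \<Omega>"
  shows "(\<lambda>x. c * \<phi> x) \<in> testfns \<Omega>"
proof (rule testfnsI(1)[where K = "tsupp \<phi>"])
  show "smooth_fun (\<lambda>x. c * \<phi> x)"
    using assms by (intro smooth_fun_cmult testfns_smooth)
qed (use assms in \<open>auto simp: testfns_def not_in_tsupp\<close>)

lemma testfns_diff:
  assumes "\<phi> \<in> testfns \<Omega>" "\<psi> \<in> testfns \<Omega>"
  shows "(\<lambda>x. \<phi> x - \<psi> x) \<in> testfns \<Omega>"
  using testfns_add[OF assms(1) testfns_cmult[OF assms(2), of "-1"]] by simp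

lemma testfns_divide: "\<phi> \<in> testfns \<Omega> \<Longrightarrow> (\<lambda>x. \<phi> x / c) \<in> testfns \<Omega>"
  using testfns_cmult[of \<phi> \<Omega> "1 / c"] by simp

section \<open>Supremum norms and continuous seminorms\<close>

lemma supnorm_le: "(\<And>x. norm (g x) \<le> b) \<Longrightarrow> supnorm g \<le> b"
  unfolding supnorm_def by (rule cSup_least) auto

lemma supnorm_nonneg: "bounded (range g) \<Longrightarrow> 0 \<le> supnorm g"
  unfolding supnorm_def bounded_iff by (rule cSup_upper2[where x = "norm (g undefined)"]) (auto intro: bdd_aboveI)

lemma norm_le_supnorm: "bounded (range g) \<Longrightarrow> norm (g x) \<le> supnorm g"
  unfolding supnorm_def bounded_iff by (rule cSup_upper) (auto intro: bdd_aboveI)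

text \<open>A real supremum carries information only for bounded sets; this makes
  \<open>supnorm\<close> of derivatives of test functions meaningful.\<close>

lemma bounded_range_pd:
  assumes "\<phi> \<in> testfns \<Omega>" "set vs \<subseteq> Basis"
  shows "bounded (range (pd vs \<phi>))"
proof -
  have K: "compact (tsupp \<phi>)" using assms(1) by (simp add: testfns_def)
  have "continuous_on (tsupp \<phi>) (pd vs \<phi>)"
    using assms by (intro smooth_fun_continuous_on smooth_fun_pd) (auto simp: testfns_def)
  then have "bounded (insert 0 (pd vs \<phi> ` tsupp \<phi>))"
    using K by (simp add: compact_continuous_image compact_imp_bounded)
  moreover have "range (pd vs \<phi>) \<subseteq> insert 0 (pd vs \<phi> ` tsupp \<phi>)"
    using pd_eq_0_outside_closed[OF compact_imp_closed[OF K], of \<phi> _ vs] not_in_tsupp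
    by fastforce
  ultimately show ?thesis by (rule bounded_subset)
qed

lemma finite_dirs: "finite (dirs m)"
  unfolding dirs_def by (rule finite_lists_length_le) simp

text \<open>Through these seminorms, limits in the space of test functions become uniform limits of
  partial derivatives. Continuity is immediate, since the value is one summand of the bounding sum
  with \<open>m = length vs\<close>.\<close>

lemma cont_seminorm_supnorm_pd:
  fixes \<Omega> :: "'a::euclidean_space set"
  assumes vs: "set vs \<subseteq> Basis"
  shows "cont_seminorm \<Omega> (\<lambda>\<phi>. supnorm (pd vs \<phi>))"
  unfolding cont_seminorm_def
proof (intro conjI ballI allI impI)
  fix \<phi> \<psi> :: "'a \<Rightarrow> complex" and c
  assume \<phi>: "\<phi> \<in> testfns \<Omega>"
  note b\<phi> = norm_le_supnorm[OF bounded_range_pd[OF \<phi> vs]]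
  show "supnorm (pd vs (\<lambda>x. \<phi> x + \<psi> x)) \<le> supnorm (pd vs \<phi>) + supnorm (pd vs \<psi>)"
    if \<psi>: "\<psi> \<in> testfns \<Omega>"
    using \<phi> \<psi> vs b\<phi> norm_le_supnorm[OF bounded_range_pd[OF \<psi> vs]]
    by (subst pd_add) (auto simp: testfns_smooth intro!: supnorm_le norm_triangle_mono)
  have "supnorm (\<lambda>x. c * pd vs \<phi> x) = norm c * supnorm (pd vs \<phi>)"
  proof (cases "c = 0")
    case False
    have "supnorm (\<lambda>x. c * pd vs \<phi> x) \<le> norm c * supnorm (pd vs \<phi>)"
      by (rule supnorm_le) (simp add: norm_mult b\<phi> mult_left_mono)
    moreover have "supnorm (pd vs \<phi>) \<le> supnorm (\<lambda>x. c * pd vs \<phi> x) / norm c"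
    proof (rule supnorm_le)
      fix x
      have "bounded (range (\<lambda>x. c * pd vs \<phi> x))"
        using bounded_range_pd[OF testfns_cmult[OF \<phi>, of c] vs] \<phi> vs
        by (simp add: pd_cmult testfns_smooth)
      from norm_le_supnorm[OF this, of x]
      show "norm (pd vs \<phi> x) \<le> supnorm (\<lambda>x. c * pd vs \<phi> x) / norm c"
        using False by (simp add: norm_mult field_simps)
    qed
    ultimately show ?thesis
      using False by (simp add: field_simps)
  qed (simp add: supnorm_def)
  then show "supnorm (pd vs (\<lambda>x. c * \<phi> x)) = norm c * supnorm (pd vs \<phi>)"
    using \<phi> vs by (simp add: pd_cmult testfns_smooth)
next
  have "supnorm (pd vs \<phi>) \<le> 1 * (\<Sum>us\<in>dirs (length vs). supnorm (pd us \<phi>))"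
    if \<phi>: "\<phi> \<in> testfns \<Omega>" for \<phi>
  proof -
    have "supnorm (pd vs \<phi>) \<le> (\<Sum>us\<in>dirs (length vs). supnorm (pd us \<phi>))"
    proof (rule member_le_sum)
      show "vs \<in> dirs (length vs)" using vs by (simp add: dirs_def)
      show "0 \<le> supnorm (pd us \<phi>)" if "us \<in> dirs (length vs) - {vs}" for us
        using that by (intro supnorm_nonneg bounded_range_pd[OF \<phi>]) (simp add: dirs_def)
    qed (rule finite_dirs)
    then show ?thesis by simp
  qed
  then show "\<exists>C m. \<forall>\<phi>\<in>testfns \<Omega>. tsupp \<phi> \<subseteq> K \<longrightarrow>
      supnorm (pd vs \<phi>) \<le> C * (\<Sum>us\<in>dirs m. supnorm (pd us \<phi>))" for K
    by blast
qed

lemma cont_seminorm_add: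
  "cont_seminorm \<Omega> p \<Longrightarrow> \<phi> \<in> testfns \<Omega> \<Longrightarrow> \<psi> \<in> testfns \<Omega> \<Longrightarrow> p (\<lambda>x. \<phi> x + \<psi> x) \<le> p \<phi> + p \<psi>"
  unfolding cont_seminorm_def by simp

lemma cont_seminorm_cmult:
  "cont_seminorm \<Omega> p \<Longrightarrow> \<phi> \<in> testfns \<Omega> \<Longrightarrow> p (\<lambda>x. c * \<phi> x) = norm c * p \<phi>"
  unfolding cont_seminorm_def by simp

lemma cont_seminorm_bound:
  assumes "cont_seminorm \<Omega> p" "compact K" "K \<subseteq> \<Omega>"
  obtains C m where "\<And>\<phi>. \<phi> \<in> testfns \<Omega> \<Longrightarrow> tsupp \<phi> \<subseteq> K \<Longrightarrow> p \<phi> \<le> C * (\<Sum>vs\<in>dirs m. supnorm (pd vs \<phi>))"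
  using assms unfolding cont_seminorm_def by meson

text \<open>Homogeneity gives value 0 at the zero function and equal values at \<open>\<phi>\<close>
  and its negative, so subadditivity yields that \<open>2 * p \<phi>\<close> is nonnegative.\<close>

lemma cont_seminorm_nonneg:
  assumes p: "cont_seminorm \<Omega> p" and \<phi>: "\<phi> \<in> testfns \<Omega>"
  shows "0 \<le> p \<phi>"
proof -
  have "p (\<lambda>x. \<phi> x + (-1) * \<phi> x) \<le> p \<phi> + p (\<lambda>x. (-1) * \<phi> x)"
    by (rule cont_seminorm_add[OF p \<phi> testfns_cmult[OF \<phi>]])
  then show ?thesis
    using cont_seminorm_cmult[OF p \<phi>, of 0] cont_seminorm_cmult[OF p \<phi>, of "-1"] by simp
qed

text \<open>Differentiability implies continuity in each seminorm: the increment is \<open>h\<close>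
  times the sum of the quotient error and \<open>c'\<close>.\<close>

lemma curve_seminorm_tendsto:
  assumes p: "cont_seminorm \<Omega> p"
    and c: "\<And>t. c t \<in> testfns \<Omega>" and c': "c' \<in> testfns \<Omega>"
    and lim: "((\<lambda>h. p (\<lambda>\<xi>. (c (t + h) \<xi> - c t \<xi>) / complex_of_real h - c' \<xi>)) \<longlongrightarrow> 0) (at 0)"
  shows "((\<lambda>h. p (\<lambda>\<xi>. c (t + h) \<xi> - c t \<xi>)) \<longlongrightarrow> 0) (at 0)"
proof (rule tendsto_sandwich)
  let ?q = "\<lambda>h \<xi>. (c (t + h) \<xi> - c t \<xi>) / complex_of_real h - c' \<xi>"
  have diff: "(\<lambda>\<xi>. c (t + h) \<xi> - c t \<xi>) \<in> testfns \<Omega>" for h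
    by (intro testfns_diff c)
  have q: "?q h \<in> testfns \<Omega>" for h
    by (intro testfns_diff testfns_divide c c')
  show "\<forall>\<^sub>F h in at 0. 0 \<le> p (\<lambda>\<xi>. c (t + h) \<xi> - c t \<xi>)"
    using cont_seminorm_nonneg[OF p diff] by simp
  have "p (\<lambda>\<xi>. c (t + h) \<xi> - c t \<xi>) \<le> \<bar>h\<bar> * (p (?q h) + p c')" if "h \<noteq> 0" for h
  proof -
    have eq: "(\<lambda>\<xi>. c (t + h) \<xi> - c t \<xi>) = (\<lambda>\<xi>. complex_of_real h * (?q h \<xi> + c' \<xi>))"
      using that by auto
    have "p (\<lambda>\<xi>. complex_of_real h * (?q h \<xi> + c' \<xi>)) = \<bar>h\<bar> * p (\<lambda>\<xi>. ?q h \<xi> + c' \<xi>)"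
      by (simp only: cont_seminorm_cmult[OF p testfns_add[OF q c']] norm_of_real)
    also have "\<dots> \<le> \<bar>h\<bar> * (p (?q h) + p c')"
      by (intro mult_left_mono cont_seminorm_add[OF p q c']) simp
    finally show ?thesis by (subst eq)
  qed
  then show "\<forall>\<^sub>F h in at 0. p (\<lambda>\<xi>. c (t + h) \<xi> - c t \<xi>) \<le> \<bar>h\<bar> * (p (?q h) + p c')"
    by (auto simp: eventually_at_filter)
  have "((\<lambda>h. \<bar>h\<bar> * (p (?q h) + p c')) \<longlongrightarrow> \<bar>0\<bar> * (0 + p c')) (at 0)"
    by (intro tendsto_intros lim)
  then show "((\<lambda>h. \<bar>h\<bar> * (p (?q h) + p c')) \<longlongrightarrow> 0) (at 0)"
    by simp
qed simp

subsection \<open>Smooth curves of test functions as jointly smooth functions\<close>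

lemma pd_diff:
  assumes "smooth_fun \<phi>" "smooth_fun \<psi>" "set vs \<subseteq> Basis"
  shows "pd vs (\<lambda>x. \<phi> x - \<psi> x) = (\<lambda>x. pd vs \<phi> x - pd vs \<psi> x)"
  using pd_add[OF assms(1) smooth_fun_cmult[OF assms(2), of "-1"] assms(3)]
    pd_cmult[OF assms(2,3), of "-1"] by simp

lemma pd_divide:
  assumes "smooth_fun \<phi>" "set vs \<subseteq> Basis"
  shows "pd vs (\<lambda>x. \<phi> x / c) = (\<lambda>x. pd vs \<phi> x / c)"
  using pd_cmult[OF assms, of "1 / c"] by simp

lemma has_vector_derivative_at_quotient:
  fixes g :: "real \<Rightarrow> complex"
  assumes "((\<lambda>h. norm ((g (t + h) - g t) / complex_of_real h - g')) \<longlongrightarrow> 0) (at 0)"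
  shows "(g has_vector_derivative g') (at t)"
  unfolding has_vector_derivative_def has_derivative_at
proof
  show "bounded_linear (\<lambda>h. h *\<^sub>R g')" by (rule bounded_linear_scaleR_left)
  have "norm ((g (t + h) - g t) / complex_of_real h - g') = norm (g (t + h) - g t - h *\<^sub>R g') / norm h"
    if "h \<noteq> 0" for h
  proof -
    have "(g (t + h) - g t) / complex_of_real h - g' = (g (t + h) - g t - h *\<^sub>R g') / complex_of_real h"
      using that by (simp add: field_simps scaleR_conv_of_real)
    then show ?thesis by (simp add: norm_divide)
  qed
  then have "\<forall>\<^sub>F h in at 0. norm ((g (t + h) - g t) / complex_of_real h - g')
      = norm (g (t + h) - g t - h *\<^sub>R g') / norm h"
    by (auto simp: eventually_at_filter)
  then show "(\<lambda>h. norm (g (t + h) - g t - h *\<^sub>R g') / norm h) \<midarrow>0\<rightarrow> 0"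
    using assms by (rule Lim_transform_eventually[rotated])
qed

text \<open>The invariant family consists of all \<open>pd vs (d k t) x\<close> as functions of
  \<open>(x, t)\<close>: a spatial derivative lengthens \<open>vs\<close>, a time derivative raises
  \<open>k\<close>. Total differentiability comes from partial derivatives together with joint
  continuity.\<close>

lemma smooth_curve_D_joint_smooth:
  fixes c :: "real \<Rightarrow> 'a::euclidean_space \<Rightarrow> complex"
  assumes "smooth_curve_D \<Omega> c"
  shows "smooth_fun (\<lambda>z. c (snd z) (fst z))"
proof -
  obtain d where d: "d 0 = c" "\<And>k t. d k t \<in> testfns \<Omega>"
    and lim: "\<And>k t p. cont_seminorm \<Omega> p \<Longrightarrow>
      ((\<lambda>h. p (\<lambda>\<xi>. (d k (t + h) \<xi> - d k t \<xi>) / complex_of_real h - d (Suc k) t \<xi>)) \<longlongrightarrow> 0) (at 0)"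
    using assms unfolding smooth_curve_D_def by (elim exE conjE) simp
  have sd: "smooth_fun (d k t)" for k t
    using d(2) testfns_smooth by blast
  have tderiv: "((\<lambda>t. pd vs (d k t) x) has_vector_derivative pd vs (d (Suc k) t) x) (at t)"
    if vs: "set vs \<subseteq> Basis" for vs k x t
  proof (rule has_vector_derivative_at_quotient)
    let ?q = "\<lambda>h \<xi>. (d k (t + h) \<xi> - d k t \<xi>) / complex_of_real h - d (Suc k) t \<xi>"
    have q: "?q h \<in> testfns \<Omega>" for h
      by (intro testfns_diff testfns_divide d)
    have "pd vs (?q h) = (\<lambda>\<xi>. (pd vs (d k (t + h)) \<xi> - pd vs (d k t) \<xi>) / complex_of_real h - pd vs (d (Suc k) t) \<xi>)" for h
      using vs by (simp add: pd_diff pd_divide sd testfns_smooth[OF testfns_diff[OF d(2) d(2)]]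
          testfns_smooth[OF testfns_divide[OF testfns_diff[OF d(2) d(2)]]])
    then have "norm ((pd vs (d k (t + h)) x - pd vs (d k t) x) / complex_of_real h - pd vs (d (Suc k) t) x)
        \<le> supnorm (pd vs (?q h))" for h
      using norm_le_supnorm[OF bounded_range_pd[OF q vs], of h x] by simp
    then show "((\<lambda>h. norm ((pd vs (d k (t + h)) x - pd vs (d k t) x) / complex_of_real h
        - pd vs (d (Suc k) t) x)) \<longlongrightarrow> 0) (at 0)"
      by (intro tendsto_sandwich[OF _ _ tendsto_const lim[OF cont_seminorm_supnorm_pd[OF vs], of k t]]) auto
  qed
  \<comment> \<open>Time continuity is uniform in space, being measured by \<open>supnorm\<close>;
    it contributes one half of \<open>e\<close>, and spatial continuity at the fixed time
    \<open>t\<close> the other.\<close>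
  have cont: "isCont (\<lambda>z. pd vs (d k (snd z)) (fst z)) (x, t)" if vs: "set vs \<subseteq> Basis" for vs k x t
    unfolding continuous_at_eps_delta
  proof (intro allI impI)
    fix e :: real assume e: "e > 0"
    have "((\<lambda>h. supnorm (pd vs (\<lambda>\<xi>. d k (t + h) \<xi> - d k t \<xi>))) \<longlongrightarrow> 0) (at 0)"
      using cont_seminorm_supnorm_pd[OF vs]
      by (rule curve_seminorm_tendsto[where c' = "d (Suc k) t"]) (auto intro: d(2) lim cont_seminorm_supnorm_pd[OF vs])
    then have "\<forall>\<^sub>F h in at 0. supnorm (pd vs (\<lambda>\<xi>. d k (t + h) \<xi> - d k t \<xi>)) < e / 2"
      using e by (intro order_tendstoD(2)[where a = "e / 2" and y = 0]) auto
    then obtain \<delta>1 where \<delta>1: "\<delta>1 > 0"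
      "\<And>h. h \<noteq> 0 \<Longrightarrow> \<bar>h\<bar> < \<delta>1 \<Longrightarrow> supnorm (pd vs (\<lambda>\<xi>. d k (t + h) \<xi> - d k t \<xi>)) < e / 2"
      by (auto simp: eventually_at dist_real_def)
    have tc: "norm (pd vs (d k s) y - pd vs (d k t) y) < e / 2" if "\<bar>s - t\<bar> < \<delta>1" for s y
    proof (cases "s = t")
      case False
      have "norm (pd vs (d k s) y - pd vs (d k t) y) \<le> supnorm (pd vs (\<lambda>\<xi>. d k s \<xi> - d k t \<xi>))"
        using norm_le_supnorm[OF bounded_range_pd[OF testfns_diff[OF d(2) d(2)] vs], of k s k t y]
        by (simp add: pd_diff sd vs)
      also have "\<dots> < e / 2"
        using \<delta>1(2)[of "s - t"] that False by simp
      finally show ?thesis .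
    qed (use e in simp)
    have "isCont (pd vs (d k t)) x"
      using smooth_fun_continuous_on[OF smooth_fun_pd[OF sd vs], of UNIV k t]
      by (simp add: continuous_on_eq_continuous_at)
    then obtain \<delta>2 where \<delta>2: "\<delta>2 > 0" "\<And>y. dist y x < \<delta>2 \<Longrightarrow> dist (pd vs (d k t) y) (pd vs (d k t) x) < e / 2"
      using e unfolding continuous_at_eps_delta by (metis half_gt_zero)
    have "dist (pd vs (d k (snd z)) (fst z)) (pd vs (d k (snd (x, t))) (fst (x, t))) < e"
      if z: "dist z (x, t) < min \<delta>1 \<delta>2" for z
    proof -
      have "dist (fst z) x \<le> dist z (x, t)" "dist (snd z) t \<le> dist z (x, t)"
        using dist_fst_le[of z "(x, t)"] dist_snd_le[of z "(x, t)"] by auto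
      then have "dist (fst z) x < \<delta>2" "\<bar>snd z - t\<bar> < \<delta>1"
        using z by (auto simp: dist_real_def)
      then have "dist (pd vs (d k (snd z)) (fst z)) (pd vs (d k t) (fst z)) < e / 2"
        "dist (pd vs (d k t) (fst z)) (pd vs (d k t) x) < e / 2"
        using tc \<delta>2(2) by (auto simp: dist_norm)
      then show ?thesis
        by (simp add: dist_triangle_half_r[of "pd vs (d k t) (fst z)"] dist_commute)
    qed
    then show "\<exists>\<delta>>0. \<forall>z. dist z (x, t) < \<delta> \<longrightarrow>
        dist (pd vs (d k (snd z)) (fst z)) (pd vs (d k (snd (x, t))) (fst (x, t))) < e"
      using \<delta>1(1) \<delta>2(1) by (intro exI[of _ "min \<delta>1 \<delta>2"]) auto
  qed
  define W where "W vs k = (\<lambda>z. pd vs (d k (snd z)) (fst z))" for vs k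
  have WD: "(W vs k has_derivative (\<lambda>(v, r). pd [v] (pd vs (d k t)) x + r *\<^sub>R W vs (Suc k) (x, t))) (at (x, t))"
    if vs: "set vs \<subseteq> Basis" for vs k x t
  proof -
    have "((\<lambda>(x, t). pd vs (d k t) x) has_derivative
        (\<lambda>(v, r). pd [v] (pd vs (d k t)) x + blinfun_apply (blinfun_scaleR_left (pd vs (d (Suc k) t) x)) r))
        (at (x, t) within UNIV \<times> UNIV)"
    \<comment> \<open>The time derivative is the partial derivative supplied everywhere and with
      joint continuity, which \<open>cont\<close> provides at order \<open>Suc k\<close>.\<close>
    proof (rule has_derivative_partialsI)
      show "((\<lambda>x. pd vs (d k t) x) has_derivative (\<lambda>v. pd [v] (pd vs (d k t)) x)) (at x within UNIV)"
        using smooth_fun_has_derivative[OF smooth_fun_pd[OF sd vs]] by simp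
      show "((\<lambda>t. pd vs (d k t) x) has_derivative
          blinfun_apply (blinfun_scaleR_left (pd vs (d (Suc k) t) x))) (at t within UNIV)" for x t
        using tderiv[OF vs] by (simp add: has_vector_derivative_def blinfun_scaleR_left.rep_eq[abs_def])
      have "isCont (\<lambda>z. blinfun_scaleR_left (pd vs (d (Suc k) (snd z)) (fst z))) (x, t)"
        by (intro bounded_linear.continuous[OF bounded_linear_blinfun_scaleR_left] cont[OF vs])
      then show "continuous (at (x, t) within UNIV \<times> UNIV) (\<lambda>(x, t). blinfun_scaleR_left (pd vs (d (Suc k) t) x))"
        by (simp add: case_prod_unfold)
    qed auto
    then show ?thesis
      by (simp add: W_def case_prod_unfold)
  qed
  show ?thesis
  proof (rule smooth_fun_coinduct[where F = "{W vs k | vs k. set vs \<subseteq> Basis}"])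
    have "W [] 0 = (\<lambda>z. c (snd z) (fst z))" by (simp add: W_def d(1))
    then show "(\<lambda>z. c (snd z) (fst z)) \<in> {W vs k | vs k. set vs \<subseteq> Basis}"
      by (metis (mono_tags, lifting) empty_set empty_subsetI mem_Collect_eq)
    show "w differentiable at z" if "w \<in> {W vs k | vs k. set vs \<subseteq> Basis}" for w and z :: "'a \<times> real"
      using that WD[of _ _ "snd z" "fst z"] by (auto intro: differentiableI)
    fix w and b :: "'a \<times> real"
    assume "w \<in> {W vs k | vs k. set vs \<subseteq> Basis}" and b: "b \<in> Basis"
    then obtain vs k where w: "w = W vs k" and vs: "set vs \<subseteq> Basis" by blast
    have pdw: "pd [b] w z = pd [fst b] (pd vs (d k (snd z))) (fst z) + snd b *\<^sub>R W vs (Suc k) z" for z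
      using pd_single_eqI[OF WD[OF vs, of k "snd z" "fst z"], of b] by (simp add: w case_prod_unfold)
    have zero: "pd [0] (pd vs (d k t)) x = 0" for t x
      using linear_0[OF has_derivative_linear[OF smooth_fun_has_derivative[OF smooth_fun_pd[OF sd vs]]]] .
    consider v where "v \<in> Basis" "b = (v, 0)" | "b = (0, 1)"
      using b by (auto simp: Basis_prod_def)
    then show "pd [b] w \<in> {W vs k | vs k. set vs \<subseteq> Basis}"
    proof cases
      case 1
      then have "pd [b] w = W (fst b # vs) k"
        using pdw by (auto simp: W_def pd_Cons[of _ vs])
      then show ?thesis using 1 vs by (auto intro!: exI[of _ "fst b # vs"])
    next
      case 2
      then have "pd [b] w = W vs (Suc k)"
        using pdw zero by (auto simp: W_def)
      then show ?thesis using vs by blast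
    qed
  qed
qed

lemma zero_one_Basis: "(0, 1) \<in> (Basis :: ('a::euclidean_space \<times> real) set)"
  by (simp add: Basis_prod_def)

lemma smooth_fun_slice:
  fixes w :: "'a::euclidean_space \<times> real \<Rightarrow> complex"
  assumes "smooth_fun w"
  shows "smooth_fun (\<lambda>x. w (x, t))"
  by (intro smooth_fun_compose[OF assms] smooth_map_Pair smooth_map_const smooth_map_linear bounded_linear_ident)

text \<open>Seminorms see spatial derivatives of time slices; this expresses them by the joint
  function, to which uniform estimates apply.\<close>

lemma pd_slice:
  fixes w :: "'a::euclidean_space \<times> real \<Rightarrow> complex"
  assumes "smooth_fun w" "set vs \<subseteq> Basis"
  shows "pd vs (\<lambda>x. w (x, t)) = (\<lambda>x. pd (map (\<lambda>v. (v, 0)) vs) w (x, t))"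
  using assms(2)
proof (induction vs)
  case (Cons v vs)
  let ?W = "pd (map (\<lambda>v. (v, 0)) vs) w"
  have "smooth_fun ?W"
    using Cons.prems by (intro smooth_fun_pd assms) (auto simp: Basis_prod_def)
  note DW = smooth_fun_has_derivative[OF this]
  have D: "((\<lambda>x. (x, t)) has_derivative (\<lambda>h. (h, 0))) (at x)" for x
    by (intro has_derivative_Pair has_derivative_ident has_derivative_const)
  have "pd [v] (\<lambda>x. ?W (x, t)) = (\<lambda>x. pd [(v, 0)] ?W (x, t))"
    by (rule ext) (rule pd_single_eqI[OF has_derivative_compose[OF D DW]])
  then show ?case
    using Cons by (simp add: pd_Cons[of v vs] pd_Cons[of "(v, 0)" "map (\<lambda>v. (v, 0)) vs"])
qed simp

text \<open>The time derivative is uniformly continuous on \<open>K\<close> times a compact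
  interval, so the mean value inequality bounds the quotient error uniformly over \<open>K\<close>;
  outside \<open>K\<close> everything vanishes.\<close>

lemma quotient_supnorm_tendsto:
  fixes W :: "'a::euclidean_space \<times> real \<Rightarrow> complex"
  assumes W: "smooth_fun W" and K: "compact K" and zero: "\<And>x t. x \<notin> K \<Longrightarrow> W (x, t) = 0"
  shows "((\<lambda>h. supnorm (\<lambda>x. (W (x, t + h) - W (x, t)) / complex_of_real h - pd [(0, 1)] W (x, t))) \<longlongrightarrow> 0) (at 0)"
    (is "((\<lambda>h. supnorm (?q h)) \<longlongrightarrow> 0) (at 0)")
proof (rule tendstoI)
  fix e :: real assume e: "e > 0"
  let ?W' = "pd [(0, 1)] W"
  have W': "smooth_fun ?W'"
    using zero_one_Basis by (intro smooth_fun_pd W) auto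
  have zero': "?W' (x, t) = 0" if "x \<notin> K" for x t
    using that zero
    by (intro pd_eq_0_outside_closed[OF closed_Times[OF compact_imp_closed[OF K] closed_UNIV]]) auto
  have Wt: "((\<lambda>t. W (x, t)) has_vector_derivative ?W' (x, s)) (at s within S)" for x s S
    using smooth_fun_line_derivative[OF W, of "(x, 0)" "(0, 1)" s S] by simp
  have "uniformly_continuous_on (K \<times> {t - 1..t + 1}) ?W'"
    using K by (intro compact_uniformly_continuous compact_Times smooth_fun_continuous_on W') auto
  then obtain \<delta> where \<delta>: "\<delta> > 0"
    "\<And>z z'. z \<in> K \<times> {t - 1..t + 1} \<Longrightarrow> z' \<in> K \<times> {t - 1..t + 1} \<Longrightarrow> dist z' z < \<delta> \<Longrightarrow> dist (?W' z') (?W' z) < e / 2"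
    using uniformly_continuous_onE[of _ ?W' "e / 2"] e by (metis half_gt_zero)
  \<comment> \<open>The bound 1 keeps the segment from \<open>t\<close> to \<open>t + h\<close> in
    the interval of uniform continuity; \<open>e / 2\<close> makes the inequality strict after
    passing to the supremum.\<close>
  have "dist (supnorm (?q h)) 0 < e" if h: "h \<noteq> 0" "\<bar>h\<bar> < min \<delta> 1" for h
  proof -
    have le: "norm (?q h x) \<le> e / 2" for x
    proof (cases "x \<in> K")
      case True
      have near: "norm (?W' (x, s) - ?W' (x, t)) \<le> e / 2" if "s \<in> closed_segment t (t + h)" for s
      proof -
        have s: "\<bar>s - t\<bar> \<le> \<bar>h\<bar>"
          using that by (auto simp: closed_segment_eq_real_ivl split: if_splits)
        then have "dist (x, s) (x, t) < \<delta>"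
          using h by (simp add: dist_Pair_Pair dist_real_def)
        then have "dist (?W' (x, s)) (?W' (x, t)) < e / 2"
          using True s h by (intro \<delta>(2)) auto
        then show ?thesis by (simp add: dist_norm)
      qed
      have "norm (W (x, t + h) - W (x, t) - ((t + h) - t) *\<^sub>R ?W' (x, t)) \<le> norm ((t + h) - t) * (e / 2)"
        by (rule vector_differentiable_bound_linearization[where S = "closed_segment t (t + h)", OF Wt])
           (use near in auto)
      then have "norm (W (x, t + h) - W (x, t) - h *\<^sub>R ?W' (x, t)) \<le> \<bar>h\<bar> * (e / 2)"
        by simp
      moreover have "?q h x = (W (x, t + h) - W (x, t) - h *\<^sub>R ?W' (x, t)) / complex_of_real h"
        using h by (simp add: field_simps scaleR_conv_of_real)
      ultimately show ?thesis
        using h by (simp add: norm_divide divide_le_eq mult.commute)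
    next
      case False
      then show ?thesis using zero zero' e by simp
    qed
    then have "bounded (range (?q h))"
      unfolding bounded_iff by blast
    from supnorm_nonneg[OF this] supnorm_le[of "?q h", OF le] e show ?thesis
      by (simp add: dist_real_def)
  qed
  then show "\<forall>\<^sub>F h in at 0. dist (supnorm (?q h)) 0 < e"
    using \<delta>(1) unfolding eventually_at dist_real_def
    by (intro exI[of _ "min \<delta> 1"]) auto
qed

text \<open>All quotients are supported in the one compact set \<open>K\<close>, where a continuous
  seminorm is dominated by finitely many suprema of derivatives. Each of these tends to 0 by the
  uniform estimate for difference quotients in time.\<close>

lemma joint_smooth_imp_smooth_curve_D:
  fixes u :: "'a::euclidean_space \<times> real \<Rightarrow> complex"
  assumes u: "smooth_fun u" and K: "compact K" "K \<subseteq> \<Omega>"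
    and zero: "\<And>x t. x \<notin> K \<Longrightarrow> u (x, t) = 0"
  shows "smooth_curve_D \<Omega> (\<lambda>t x. u (x, t))"
proof -
  define D where "D k = pd (replicate k (0, 1)) u" for k
  have D: "smooth_fun (D k)" for k
    unfolding D_def using zero_one_Basis by (intro smooth_fun_pd u) auto
  have DSuc: "D (Suc k) = pd [(0, 1)] (D k)" for k
    unfolding D_def using pd_Cons[of "(0, 1)" "replicate k (0, 1)" u] by simp
  have D0: "pd us (D k) (x, t) = 0" if "x \<notin> K" for us k x t
    using that zero unfolding D_def pd_append[symmetric]
    by (intro pd_eq_0_outside_closed[OF closed_Times[OF compact_imp_closed[OF K(1)] closed_UNIV]]) auto
  note D00 = D0[where us = "[]", simplified]
  have test: "(\<lambda>x. D k (x, t)) \<in> testfns \<Omega>" for k t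
    using K D00 by (intro testfnsI(1) smooth_fun_slice D) auto
  show ?thesis
    unfolding smooth_curve_D_def
  proof (intro exI[of _ "\<lambda>k t x. D k (x, t)"] conjI allI impI)
    show "(\<lambda>t x. D 0 (x, t)) = (\<lambda>t x. u (x, t))" by (simp add: D_def)
    show "(\<lambda>x. D k (x, t)) \<in> testfns \<Omega>" for k t by (rule test)
    fix k t p assume p: "cont_seminorm \<Omega> p"
    let ?q = "\<lambda>h x. (D k (x, t + h) - D k (x, t)) / complex_of_real h - D (Suc k) (x, t)"
    obtain C m where C: "\<And>\<phi>. \<phi> \<in> testfns \<Omega> \<Longrightarrow> tsupp \<phi> \<subseteq> K \<Longrightarrow> p \<phi> \<le> C * (\<Sum>vs\<in>dirs m. supnorm (pd vs \<phi>))"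
      using cont_seminorm_bound[OF p K] by blast
    have q: "?q h \<in> testfns \<Omega>" for h
      by (intro testfns_diff testfns_divide test)
    have qK: "tsupp (?q h) \<subseteq> K" for h
      using K D00 by (simp add: tsupp_subset_iff compact_imp_closed)
    have "((\<lambda>h. supnorm (pd vs (?q h))) \<longlongrightarrow> 0) (at 0)" if "vs \<in> dirs m" for vs
    proof -
      have vs: "set vs \<subseteq> Basis" using that by (simp add: dirs_def)
      let ?vs = "map (\<lambda>v. (v, 0)) vs" let ?W = "pd ?vs (D k)"
      have vs': "set ?vs \<subseteq> Basis" using vs by (auto simp: Basis_prod_def)
      have "pd vs (?q h) = (\<lambda>x. (?W (x, t + h) - ?W (x, t)) / complex_of_real h - pd ?vs (D (Suc k)) (x, t))" for h
        using vs by (simp add: pd_diff pd_divide pd_slice D smooth_fun_slice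
            testfns_smooth[OF testfns_diff[OF test test]]
            testfns_smooth[OF testfns_divide[OF testfns_diff[OF test test]]])
      \<comment> \<open>Symmetry of mixed derivatives turns the spatial derivative of the next time
        derivative into the time derivative of \<open>?W\<close>, as the quotient estimate
        requires.\<close>
      moreover have "pd ?vs (D (Suc k)) = pd [(0, 1)] ?W"
        unfolding DSuc using vs' zero_one_Basis by (intro pd_commute_list D)
      ultimately show ?thesis
        using quotient_supnorm_tendsto[OF smooth_fun_pd[OF D vs'] K(1) D0, of k t] by simp
    qed
    then have lim: "((\<lambda>h. C * (\<Sum>vs\<in>dirs m. supnorm (pd vs (?q h)))) \<longlongrightarrow> 0) (at 0)"
      by (intro tendsto_mult_right_zero tendsto_null_sum)
    show "((\<lambda>h. p (?q h)) \<longlongrightarrow> 0) (at 0)"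
    proof (rule tendsto_sandwich[OF _ _ tendsto_const lim])
      show "\<forall>\<^sub>F h in at 0. 0 \<le> p (?q h)"
        using cont_seminorm_nonneg[OF p q] by (rule always_eventually[OF allI])
      show "\<forall>\<^sub>F h in at 0. p (?q h) \<le> C * (\<Sum>vs\<in>dirs m. supnorm (pd vs (?q h)))"
        using C[OF q qK] by (rule always_eventually[OF allI])
    qed
  qed
qed

section \<open>Local boundedness of the supports along a smooth curve\<close>

lemma smooth_curve_D_testfns: "smooth_curve_D \<Omega> c \<Longrightarrow> c t \<in> testfns \<Omega>"
  unfolding smooth_curve_D_def by (elim exE conjE) auto

lemma smooth_curve_D_continuous:
  assumes p: "cont_seminorm \<Omega> p" and "smooth_curve_D \<Omega> c"
  shows "((\<lambda>h. p (\<lambda>\<xi>. c (t + h) \<xi> - c t \<xi>)) \<longlongrightarrow> 0) (at 0)"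
proof -
  obtain d where d: "d 0 = c" "\<And>k t. d k t \<in> testfns \<Omega>"
    and lim: "\<And>k t p. cont_seminorm \<Omega> p \<Longrightarrow>
      ((\<lambda>h. p (\<lambda>\<xi>. (d k (t + h) \<xi> - d k t \<xi>) / complex_of_real h - d (Suc k) t \<xi>)) \<longlongrightarrow> 0) (at 0)"
    using assms(2) unfolding smooth_curve_D_def by (elim exE conjE) simp
  from curve_seminorm_tendsto[OF p d(2) d(2) lim[OF p], of 0 t] show ?thesis
    by (simp add: d(1))
qed

text \<open>If the supports escaped every compact set along \<open>t n \<longlonglongrightarrow> t0\<close>, say at points \<open>x n\<close>,
  then the seminorm \<open>\<Sum>n. n * norm (\<phi> (x n)) / norm (c (t n) (x n))\<close>, a finite sum on each
  step of the inductive limit, would be continuous but unbounded along the curve.\<close>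

lemma smooth_curve_D_local_support:
  fixes \<Omega> :: "'a::euclidean_space set"
  assumes "open \<Omega>" and c: "smooth_curve_D \<Omega> c"
  obtains \<delta> K where "\<delta> > 0" "compact K" "K \<subseteq> \<Omega>" "\<And>t x. \<bar>t - t0\<bar> < \<delta> \<Longrightarrow> x \<notin> K \<Longrightarrow> c t x = 0"
proof (rule ccontr)
  assume "\<not> thesis"
  with that have escape: "\<exists>t x. \<bar>t - t0\<bar> < \<delta> \<and> x \<notin> K \<and> c t x \<noteq> 0" if "\<delta> > 0" "compact K" "K \<subseteq> \<Omega>" for \<delta> K
    using \<open>\<delta> > 0\<close> \<open>compact K\<close> \<open>K \<subseteq> \<Omega>\<close> by metis
  obtain C where C: "\<And>n. compact (C n)" "\<And>n. C n \<subseteq> \<Omega>"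
    and "\<And>n. C n \<subseteq> interior (C (Suc n))" "\<Union> (range C) = \<Omega>"
    and exh: "\<And>K. compact K \<Longrightarrow> K \<subseteq> \<Omega> \<Longrightarrow> \<exists>N. \<forall>n\<ge>N. K \<subseteq> C n"
    by (rule open_Union_compact_subsets[OF assms(1)]) (rule that)
  have "\<exists>t x. \<bar>t - t0\<bar> < 1 / real (Suc n) \<and> x \<notin> C n \<and> c t x \<noteq> 0" for n
    using C by (intro escape) auto
  then obtain T X where T: "\<And>n. \<bar>T n - t0\<bar> < 1 / real (Suc n)"
    and X: "\<And>n. X n \<notin> C n" "\<And>n. c (T n) (X n) \<noteq> 0"
    by metis
  define a where "a n = real n / norm (c (T n) (X n))" for n
  have a: "a n \<ge> 0" for n by (simp add: a_def)
  define p where "p \<phi> = (\<Sum>n. a n * norm (\<phi> (X n)))" for \<phi> :: "'a \<Rightarrow> complex"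
  have p_eq: "p \<phi> = (\<Sum>n<N. a n * norm (\<phi> (X n)))" if "\<And>n. n \<ge> N \<Longrightarrow> \<phi> (X n) = 0" for \<phi> N
    unfolding p_def using that by (intro suminf_finite) auto
  \<comment> \<open>A compact support lies in \<open>C n\<close> for all large \<open>n\<close>,
    whereas \<open>X n\<close> does not, so the series for \<open>p\<close> is a finite sum on each
    test function.\<close>
  have vanish: "\<exists>N. \<forall>n\<ge>N. \<phi> (X n) = 0" if "\<phi> \<in> testfns \<Omega>" for \<phi>
    using that exh[of "tsupp \<phi>"] X(1) not_in_tsupp[of _ \<phi>] unfolding testfns_def by blast
  have p: "cont_seminorm \<Omega> p"
    unfolding cont_seminorm_def
  proof (intro conjI ballI allI impI)
    fix \<phi> \<psi> b assume \<phi>: "\<phi> \<in> testfns \<Omega>"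
    obtain N1 where N1: "\<And>n. n \<ge> N1 \<Longrightarrow> \<phi> (X n) = 0" using vanish[OF \<phi>] by blast
    show "p (\<lambda>x. \<phi> x + \<psi> x) \<le> p \<phi> + p \<psi>" if \<psi>: "\<psi> \<in> testfns \<Omega>"
    proof -
      obtain N2 where N2: "\<And>n. n \<ge> N2 \<Longrightarrow> \<psi> (X n) = 0" using vanish[OF \<psi>] by blast
      define N where "N = max N1 N2"
      have "p (\<lambda>x. \<phi> x + \<psi> x) = (\<Sum>n<N. a n * norm (\<phi> (X n) + \<psi> (X n)))"
        using N1 N2 by (intro p_eq) (auto simp: N_def)
      also have "\<dots> \<le> (\<Sum>n<N. a n * norm (\<phi> (X n)) + a n * norm (\<psi> (X n)))"
        unfolding distrib_left[symmetric] by (intro sum_mono mult_left_mono norm_triangle_ineq a)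
      also have "\<dots> = p \<phi> + p \<psi>"
        using N1 N2 by (subst (1 2) p_eq[of N]) (auto simp: N_def sum.distrib)
      finally show ?thesis .
    qed
    show "p (\<lambda>x. b * \<phi> x) = norm b * p \<phi>"
      using N1 by (simp add: p_eq[of N1] sum_distrib_left norm_mult mult_ac)
  next
    fix K assume "compact K \<and> K \<subseteq> \<Omega>"
    then obtain N where N: "\<And>n. n \<ge> N \<Longrightarrow> K \<subseteq> C n" using exh by blast
    \<comment> \<open>Order \<open>m = 0\<close> suffices, since \<open>p\<close> only evaluates
      functions at points.\<close>
    have d0: "dirs 0 = {[] :: 'a list}" by (auto simp: dirs_def)
    have "p \<phi> \<le> (\<Sum>n<N. a n) * (\<Sum>vs\<in>dirs 0. supnorm (pd vs \<phi>))"
      if \<phi>: "\<phi> \<in> testfns \<Omega>" "tsupp \<phi> \<subseteq> K" for \<phi>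
    proof -
      have "p \<phi> = (\<Sum>n<N. a n * norm (\<phi> (X n)))"
        using \<phi>(2) N X(1) by (intro p_eq not_in_tsupp) blast
      also have "\<dots> \<le> (\<Sum>n<N. a n * supnorm \<phi>)"
        using norm_le_supnorm[of \<phi>] bounded_range_pd[OF \<phi>(1), of "[]"]
        by (intro sum_mono mult_left_mono a) simp
      finally show ?thesis by (simp add: d0 sum_distrib_right)
    qed
    then show "\<exists>B m. \<forall>\<phi>\<in>testfns \<Omega>. tsupp \<phi> \<subseteq> K \<longrightarrow> p \<phi> \<le> B * (\<Sum>vs\<in>dirs m. supnorm (pd vs \<phi>))"
      by blast
  qed
  have big: "real n \<le> p (c (T n))" for n
  proof -
    obtain N where N: "\<And>m. m \<ge> N \<Longrightarrow> c (T n) (X m) = 0"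
      using vanish[OF smooth_curve_D_testfns[OF c]] by blast
    have "n < N" using N[of n] X(2)[of n] by (meson not_le)
    then have "a n * norm (c (T n) (X n)) \<le> (\<Sum>m<N. a m * norm (c (T n) (X m)))"
      by (intro member_le_sum) (auto simp: a)
    then show ?thesis
      using N X(2)[of n] by (simp add: p_eq[of N] a_def)
  qed
  have "\<forall>\<^sub>F h in at 0. p (\<lambda>\<xi>. c (t0 + h) \<xi> - c t0 \<xi>) < 1"
    by (rule order_tendstoD(2)[OF smooth_curve_D_continuous[OF p c]]) simp
  then obtain \<delta> where \<delta>: "\<delta> > 0" "\<And>h. h \<noteq> 0 \<Longrightarrow> \<bar>h\<bar> < \<delta> \<Longrightarrow> p (\<lambda>\<xi>. c (t0 + h) \<xi> - c t0 \<xi>) < 1"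
    by (auto simp: eventually_at dist_real_def)
  have small: "p (c t) \<le> 1 + p (c t0)" if "\<bar>t - t0\<bar> < \<delta>" for t
  proof (cases "t = t0")
    case False
    have "p (\<lambda>\<xi>. (c t \<xi> - c t0 \<xi>) + c t0 \<xi>) \<le> p (\<lambda>\<xi>. c t \<xi> - c t0 \<xi>) + p (c t0)"
      by (intro cont_seminorm_add[OF p] testfns_diff smooth_curve_D_testfns[OF c])
    then show ?thesis
      using \<delta>(2)[of "t - t0"] that False by simp
  qed simp
  \<comment> \<open>The first bound contradicts \<open>small\<close>, the second places
    \<open>T n\<close> within the distance \<open>\<delta>\<close> where \<open>small\<close>
    applies.\<close>
  obtain n where n: "real n > max (1 + p (c t0)) (1 / \<delta>)"
    using reals_Archimedean2 by blast
  have "1 / real (Suc n) < \<delta>"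
    using n \<delta>(1) by (simp add: field_simps)
  then have "real n \<le> 1 + p (c t0)"
    using T[of n] small[of "T n"] big[of n] by linarith
  then show False using n by simp
qed

subsection \<open>The two smooth structures\<close>

text \<open>The factor \<open>m ^ DIM('a)\<close> cancels the Jacobian of the substitution. It is
  applied with \<open>m = 1 / \<epsilon>\<close> in one direction and \<open>m = \<epsilon>\<close>
  in the other.\<close>

lemma A0_integral_affine:
  fixes \<phi> :: "'a::euclidean_space \<Rightarrow> complex"
  assumes \<phi>: "\<phi> \<in> A0 \<Omega>" and m: "m > 0"
  shows "integral UNIV (\<lambda>x. complex_of_real (m ^ DIM('a)) * \<phi> (m *\<^sub>R x + b)) = 1"
proof -
  have "bounded (tsupp \<phi>)" and s: "smooth_fun \<phi>" and int1: "integral UNIV \<phi> = 1"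
    using \<phi> by (auto simp: A0_def testfns_def compact_imp_bounded)
  then obtain l where l: "tsupp \<phi> \<subseteq> cbox (- l) l"
    using bounded_subset_cbox_symmetric by blast
  have out: "\<phi> y = 0" if "y \<notin> cbox (- l) l" for y
    using l that not_in_tsupp by blast
  \<comment> \<open>Continuity gives integrability on a box containing the support, and extension by
    zero identifies the box integral with the integral over the whole space.\<close>
  have "(\<phi> has_integral integral (cbox (- l) l) \<phi>) (cbox (- l) l)"
    using smooth_fun_continuous_on[OF s] by (intro integrable_integral integrable_continuous)
  moreover from has_integral_on_superset[OF this out, of UNIV]
  have "integral (cbox (- l) l) \<phi> = 1"
    using int1 by (simp add: integral_unique)
  ultimately have "(\<phi> has_integral 1) (cbox (- l) l)" by simp
  from has_integral_affinity[OF this, of m b] m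
  have "((\<lambda>x. \<phi> (m *\<^sub>R x + b)) has_integral (1 / m ^ DIM('a)) *\<^sub>R 1)
      ((\<lambda>x. (1 / m) *\<^sub>R x + - ((1 / m) *\<^sub>R b)) ` cbox (- l) l)"
    by simp
  then have "((\<lambda>x. \<phi> (m *\<^sub>R x + b)) has_integral (1 / m ^ DIM('a)) *\<^sub>R 1) UNIV"
  proof (rule has_integral_on_superset)
    fix x assume x: "x \<notin> (\<lambda>x. (1 / m) *\<^sub>R x + - ((1 / m) *\<^sub>R b)) ` cbox (- l) l"
    have "x = (1 / m) *\<^sub>R (m *\<^sub>R x + b) + - ((1 / m) *\<^sub>R b)"
      using m by (simp add: scaleR_add_right)
    then show "\<phi> (m *\<^sub>R x + b) = 0"
      using x out by blast
  qed simp
  from integral_unique[OF has_integral_mult_right[OF this, of "complex_of_real (m ^ DIM('a))"]]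
  show ?thesis
    using m by (simp add: scaleR_conv_of_real)
qed

text \<open>The map \<open>\<rho>\<close> allows a change of time parameter: it is the identity in
  one direction of the theorem and the \<open>tanh\<close> substitution in the other.\<close>

lemma smooth_fun_affine_substitution:
  fixes c1 :: "real \<Rightarrow> 'a::euclidean_space \<Rightarrow> complex" and \<rho> :: "'b::euclidean_space \<Rightarrow> real"
  assumes c1: "smooth_fun (\<lambda>z. c1 (snd z) (fst z))" and \<rho>: "smooth_map \<rho>" and b: "smooth_map b"
  shows "smooth_fun (\<lambda>z. a * c1 (\<rho> (snd z)) (m *\<^sub>R fst z + b (snd z)))"
proof -
  have "smooth_map (\<lambda>z :: 'a \<times> 'b. (m *\<^sub>R fst z + b (snd z), \<rho> (snd z)))"
    by (intro smooth_map_Pair smooth_map_add smooth_map_compose[OF \<rho>] smooth_map_compose[OF b] smooth_map_linear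
        bounded_linear_snd bounded_linear_const_scaleR bounded_linear_fst)
  from smooth_fun_cmult[OF smooth_fun_compose[OF c1 this]] show ?thesis by simp
qed

text \<open>A test curve is pushed forward by T after S^(eps). The inclusion in
  \<open>U_epsN\<close> confines all supports to \<open>N\<close>, so the result is a smooth curve
  for \<open>\<Omega>\<close>, and \<open>TS_inv\<close> returns the original curve.\<close>

lemma tau2_smooth_imp_tau1_smooth_on:
  fixes \<Omega> :: "'a::euclidean_space set"
  assumes \<epsilon>: "\<epsilon> > 0" and tau2: "tau2_smooth \<epsilon> \<Omega> f"
    and N: "compact N" "N \<subseteq> \<Omega>" and sub: "A0H H \<times> V \<subseteq> U_epsN \<epsilon> \<Omega> N"
  shows "tau1_smooth_on (A0H H) V f"
  unfolding tau1_smooth_on_def conv_smooth_on_def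
proof (intro allI impI, elim conjE)
  fix c1 :: "real \<Rightarrow> 'a \<Rightarrow> complex" and c2 :: "real \<Rightarrow> 'a"
  assume c1: "smooth_curve_D UNIV c1" "\<forall>t. c1 t \<in> A0H H" and c2: "smooth_curve c2" "\<forall>t. c2 t \<in> V"
  \<comment> \<open>The first component of the image of \<open>(c1 t, c2 t)\<close> under T after
    S^(eps), as a joint function of space and time.\<close>
  define u where "u z = complex_of_real ((1 / \<epsilon>) ^ DIM('a)) *
      c1 (snd z) ((1 / \<epsilon>) *\<^sub>R fst z + (- 1 / \<epsilon>) *\<^sub>R c2 (snd z))" for z
  have "smooth_map c2" using c2(1) by (simp add: smooth_curve_iff_smooth_map)
  then have "smooth_map (\<lambda>t. (- 1 / \<epsilon>) *\<^sub>R c2 t)"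
    by (rule smooth_map_compose[rotated]) (intro smooth_map_linear bounded_linear_scaleR_right)
  then have u: "smooth_fun u"
    unfolding u_def
    by (rule smooth_fun_affine_substitution[where \<rho> = "\<lambda>t. t", OF smooth_curve_D_joint_smooth[OF c1(1)]
        smooth_map_linear[OF bounded_linear_ident]])
  have zero: "u (x, t) = 0" if "x \<notin> N" for x t
  proof (rule ccontr)
    \<comment> \<open>Solves \<open>c2 t + \<epsilon> *\<^sub>R ?y = x\<close>, so the support
      condition in \<open>U_epsN\<close> at \<open>?y\<close> puts \<open>x\<close> into
      \<open>N\<close>.\<close>
    let ?y = "(1 / \<epsilon>) *\<^sub>R x + (- 1 / \<epsilon>) *\<^sub>R c2 t"
    assume "u (x, t) \<noteq> 0"
    then have "?y \<in> tsupp (c1 t)"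
      using not_in_tsupp by (force simp: u_def)
    moreover have "(c1 t, c2 t) \<in> U_epsN \<epsilon> \<Omega> N"
      using c1(2) c2(2) sub by blast
    ultimately have "c2 t + \<epsilon> *\<^sub>R ?y \<in> N"
      unfolding U_epsN_def by blast
    then show False
      using that \<epsilon> by (simp add: scaleR_diff_right)
  qed
  note curve = joint_smooth_imp_smooth_curve_D[OF u N zero]
  have "(\<lambda>x. u (x, t)) \<in> A0 \<Omega>" for t
  proof -
    have "c1 t \<in> A0 UNIV" using c1(2) by (simp add: A0H_def)
    from A0_integral_affine[OF this, of "1 / \<epsilon>" "(- 1 / \<epsilon>) *\<^sub>R c2 t"] \<epsilon>
    show ?thesis
      using smooth_curve_D_testfns[OF curve, of t] by (simp add: A0_def u_def)
  qed
  moreover have "c2 t \<in> \<Omega>" for t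
    using c1(2) c2(2) sub unfolding U_epsN_def by blast
  ultimately have "smooth_curve (\<lambda>t. (f \<circ> TS_inv \<epsilon>) ((\<lambda>x. u (x, t)), c2 t))"
    using tau2 curve c2(1) unfolding tau2_smooth_def conv_smooth_on_def by blast
  moreover have "TS_inv \<epsilon> ((\<lambda>x. u (x, t)), c2 t) = (c1 t, c2 t)" for t
    using \<epsilon> by (simp add: TS_inv_def u_def scaleR_add_right scaleR_diff_right power_divide)
  ultimately show "smooth_curve (\<lambda>t. f (c1 t, c2 t))"
    by simp
qed

text \<open>The supports along \<open>c1\<close> need not share a compact set over all times, nor
  need \<open>c2\<close> stay in a small ball. Therefore each \<open>t0\<close> receives its own
  \<open>H\<close>, \<open>V\<close> and \<open>N\<close>, and the curves are reparametrised into
  the time window where these work.\<close>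

lemma tau1_smooth_on_imp_tau2_smooth:
  fixes \<Omega> :: "'a::euclidean_space set"
  assumes "open \<Omega>" and \<epsilon>: "\<epsilon> > 0"
    and tau1: "\<And>H V N. compact H \<Longrightarrow> open V \<Longrightarrow> V \<subseteq> \<Omega> \<Longrightarrow> compact N \<Longrightarrow> N \<subseteq> \<Omega> \<Longrightarrow>
      A0H H \<times> V \<subseteq> U_epsN \<epsilon> \<Omega> N \<Longrightarrow> tau1_smooth_on (A0H H) V f"
  shows "tau2_smooth \<epsilon> \<Omega> f"
  unfolding tau2_smooth_def conv_smooth_on_def
proof (intro allI impI, elim conjE)
  fix c1 :: "real \<Rightarrow> 'a \<Rightarrow> complex" and c2 :: "real \<Rightarrow> 'a"
  assume c1: "smooth_curve_D \<Omega> c1" "\<forall>t. c1 t \<in> A0 \<Omega>" and c2: "smooth_curve c2" "\<forall>t. c2 t \<in> \<Omega>"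
  define g where "g t = (f \<circ> TS_inv \<epsilon>) (c1 t, c2 t)" for t
  have sc2: "smooth_map c2" using c2(1) by (simp add: smooth_curve_iff_smooth_map)
  have "smooth_fun g"
  proof (rule smooth_fun_tanh_local)
    fix t0
    obtain \<delta>1 K where \<delta>1: "\<delta>1 > 0" and K: "compact K" "K \<subseteq> \<Omega>"
      and supp: "\<And>t x. \<bar>t - t0\<bar> < \<delta>1 \<Longrightarrow> x \<notin> K \<Longrightarrow> c1 t x = 0"
      using smooth_curve_D_local_support[OF assms(1) c1(1)] by blast
    \<comment> \<open>Including \<open>c2 t0\<close> lets one radius serve both for fattening
      \<open>K\<close> and for \<open>V \<subseteq> \<Omega>\<close>.\<close>
    have "compact (insert (c2 t0) K)" "insert (c2 t0) K \<subseteq> \<Omega>"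
      using K c2(2) by auto
    then obtain r2 where r2: "r2 > 0" "(\<Union>x\<in>insert (c2 t0) K. cball x r2) \<subseteq> \<Omega>"
      using compact_subset_open_imp_cball_epsilon_subset[OF _ assms(1)] by metis
    \<comment> \<open>Halved because a point of \<open>V\<close> and a point of
      \<open>cball (c2 t0) r\<close> may be up to \<open>2 * r\<close> apart; this is the amount by
      which \<open>K\<close> is fattened in \<open>N\<close>.\<close>
    define r where "r = r2 / 2"
    have r: "r > 0" "\<And>x. x \<in> insert (c2 t0) K \<Longrightarrow> cball x (2 * r) \<subseteq> \<Omega>"
      using r2 by (auto simp: r_def)
    define V where "V = ball (c2 t0) r"
    define N where "N = {x + y | x y. x \<in> K \<and> y \<in> cball 0 (2 * r)}"
    \<comment> \<open>All \<open>x\<close> for which \<open>\<epsilon> *\<^sub>R x + q\<close> can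
      lie in \<open>K\<close> with \<open>q\<close> within \<open>r\<close> of \<open>c2 t0\<close>;
      hence it contains the supports of the pulled-back functions near \<open>t0\<close>.\<close>
    define H where "H = (*\<^sub>R) (1 / \<epsilon>) ` {x - y | x y. x \<in> K \<and> y \<in> cball (c2 t0) r}"
    have H: "compact H"
      unfolding H_def by (intro compact_scaling compact_differences K(1) compact_cball)
    have N: "compact N"
      unfolding N_def by (intro compact_sums K(1) compact_cball)
    have N\<Omega>: "N \<subseteq> \<Omega>"
    proof
      fix z assume "z \<in> N"
      then obtain x y where "z = x + y" "x \<in> K" "norm y \<le> 2 * r"
        by (auto simp: N_def)
      then have "z \<in> cball x (2 * r)" "x \<in> insert (c2 t0) K" by (auto simp: dist_norm)
      then show "z \<in> \<Omega>" using r(2) by blast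
    qed
    have V\<Omega>: "V \<subseteq> \<Omega>"
      using r(2)[of "c2 t0"] r(1) by (force simp: V_def)
    have sub: "A0H H \<times> V \<subseteq> U_epsN \<epsilon> \<Omega> N"
    proof clarify
      fix \<phi> x assume \<phi>: "\<phi> \<in> A0H H" and x: "x \<in> V"
      have "x + \<epsilon> *\<^sub>R y \<in> N" if "y \<in> tsupp \<phi>" for y
      proof -
        have "y \<in> H" using that \<phi> by (auto simp: A0H_def)
        then obtain k q where y: "y = (1 / \<epsilon>) *\<^sub>R (k - q)" "k \<in> K" "q \<in> cball (c2 t0) r"
          unfolding H_def by blast
        have "dist x q \<le> 2 * r"
          using x y(3) dist_triangle[of x q "c2 t0"] by (simp add: V_def dist_commute)
        then have "x - q \<in> cball 0 (2 * r)" by (simp add: dist_norm norm_minus_commute)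
        moreover have "x + \<epsilon> *\<^sub>R y = k + (x - q)"
          using \<epsilon> y(1) by simp
        ultimately show ?thesis
          using y(2) unfolding N_def by blast
      qed
      then show "(\<phi>, x) \<in> U_epsN \<epsilon> \<Omega> N"
        using \<phi> x V\<Omega> by (auto simp: U_epsN_def A0H_def)
    qed
    have "isCont c2 t0"
      using smooth_map_has_derivative[OF sc2] has_derivative_continuous by blast
    then obtain \<delta>2 where \<delta>2: "\<delta>2 > 0" "\<And>t. dist t t0 < \<delta>2 \<Longrightarrow> dist (c2 t) (c2 t0) < r"
      using r(1) unfolding continuous_at_eps_delta by blast
    define \<delta> where "\<delta> = min \<delta>1 \<delta>2"
    have \<delta>: "\<delta> > 0" using \<delta>1 \<delta>2(1) by (simp add: \<delta>_def)
    \<comment> \<open>For every real \<open>s\<close> the value stays in the window, so support and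
      base point conditions hold along the whole reparametrised curve.\<close>
    define \<rho> where "\<rho> s = t0 + \<delta> * tanh s" for s
    have "\<bar>\<rho> s - t0\<bar> < \<delta>" for s
      using \<delta> tanh_real_bounds[of s] by (simp add: \<rho>_def abs_mult abs_less_iff)
    then have near: "\<bar>\<rho> s - t0\<bar> < \<delta>1" "dist (c2 (\<rho> s)) (c2 t0) < r" for s
      using \<delta>2(2)[of "\<rho> s"] by (auto simp: \<delta>_def dist_real_def)
    have s\<rho>: "smooth_map \<rho>"
      unfolding \<rho>_def
      by (rule smooth_map_add[OF smooth_map_const
            smooth_map_compose[OF smooth_map_linear[OF bounded_linear_mult_right] smooth_map_tanh]])
    have sc2\<rho>: "smooth_map (\<lambda>s. c2 (\<rho> s))"
      by (rule smooth_map_compose[OF sc2 s\<rho>])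
    \<comment> \<open>The first component of \<open>TS_inv \<epsilon>\<close> at the reparametrised
      curve; thus \<open>f\<close> along the new curve is \<open>g\<close> composed with
      \<open>\<rho>\<close>.\<close>
    define u where "u z = complex_of_real (\<epsilon> ^ DIM('a)) *
        c1 (\<rho> (snd z)) (\<epsilon> *\<^sub>R fst z + c2 (\<rho> (snd z)))" for z
    have u: "smooth_fun u"
      unfolding u_def by (intro smooth_fun_affine_substitution smooth_curve_D_joint_smooth[OF c1(1)] s\<rho> sc2\<rho>)
    have zero: "u (x, s) = 0" if "x \<notin> H" for x s
    proof (rule ccontr)
      assume "u (x, s) \<noteq> 0"
      then have k: "\<epsilon> *\<^sub>R x + c2 (\<rho> s) \<in> K"
        using supp[OF near(1)] by (auto simp: u_def)
      have "x = (1 / \<epsilon>) *\<^sub>R ((\<epsilon> *\<^sub>R x + c2 (\<rho> s)) - c2 (\<rho> s))"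
        using \<epsilon> by simp
      moreover have "c2 (\<rho> s) \<in> cball (c2 t0) r"
        using near(2)[of s] by (simp add: dist_commute)
      ultimately show False
        using that k unfolding H_def by blast
    qed
    note curve = joint_smooth_imp_smooth_curve_D[OF u H subset_UNIV zero]
    have "(\<lambda>x. u (x, s)) \<in> A0H H" for s
    proof -
      have "tsupp (\<lambda>x. u (x, s)) \<subseteq> H"
        using zero H by (simp add: tsupp_subset_iff compact_imp_closed)
      moreover have "c1 (\<rho> s) \<in> A0 \<Omega>" using c1(2) by simp
      from A0_integral_affine[OF this \<epsilon>, of "c2 (\<rho> s)"]
      have "integral UNIV (\<lambda>x. u (x, s)) = 1" by (simp add: u_def)
      ultimately show ?thesis
        using smooth_curve_D_testfns[OF curve, of s] by (simp add: A0H_def A0_def)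
    qed
    moreover have "c2 (\<rho> s) \<in> V" for s
      using near(2)[of s] by (simp add: V_def dist_commute)
    moreover have "smooth_curve (\<lambda>s. c2 (\<rho> s))"
      using sc2\<rho> by (simp add: smooth_curve_iff_smooth_map)
    moreover have "tau1_smooth_on (A0H H) V f"
      using H N N\<Omega> V\<Omega> sub by (intro tau1[of H V N]) (auto simp: V_def)
    ultimately have "smooth_curve (\<lambda>s. f ((\<lambda>x. u (x, s)), c2 (\<rho> s)))"
      using curve unfolding tau1_smooth_on_def conv_smooth_on_def by blast
    moreover have "f ((\<lambda>x. u (x, s)), c2 (\<rho> s)) = g (\<rho> s)" for s
      by (simp add: g_def TS_inv_def u_def add.commute)
    ultimately have "smooth_fun (\<lambda>s. g (\<rho> s))"
      by (simp add: smooth_curve_iff_smooth_fun)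
    then show "\<exists>\<delta>>0. smooth_fun (\<lambda>s. g (t0 + \<delta> * tanh s))"
      using \<delta> unfolding \<rho>_def by blast
  qed
  then show "smooth_curve (\<lambda>t. (f \<circ> TS_inv \<epsilon>) (c1 t, c2 t))"
    by (simp add: g_def[abs_def] smooth_curve_iff_smooth_fun)
qed

theorem theorem6p6:
  fixes \<Omega> :: "'a::euclidean_space set"
    and \<epsilon> :: real
    and f :: "('a \<Rightarrow> complex) \<times> 'a \<Rightarrow> complex"
  assumes "open \<Omega>" and "0 < \<epsilon>" and "\<epsilon> \<le> 1"
  shows "tau2_smooth \<epsilon> \<Omega> f \<longleftrightarrow>
    (\<forall>H V. compact H \<and> open V \<and> V \<subseteq> \<Omega> \<and>
       (\<exists>N. compact N \<and> N \<subseteq> \<Omega> \<and> A0H H \<times> V \<subseteq> U_epsN \<epsilon> \<Omega> N)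
       \<longrightarrow> tau1_smooth_on (A0H H) V f)"
proof
  assume "tau2_smooth \<epsilon> \<Omega> f"
  then show "\<forall>H V. compact H \<and> open V \<and> V \<subseteq> \<Omega> \<and>
       (\<exists>N. compact N \<and> N \<subseteq> \<Omega> \<and> A0H H \<times> V \<subseteq> U_epsN \<epsilon> \<Omega> N)
       \<longrightarrow> tau1_smooth_on (A0H H) V f"
    using tau2_smooth_imp_tau1_smooth_on[OF assms(2)] by blast
next
  assume "\<forall>H V. compact H \<and> open V \<and> V \<subseteq> \<Omega> \<and>
       (\<exists>N. compact N \<and> N \<subseteq> \<Omega> \<and> A0H H \<times> V \<subseteq> U_epsN \<epsilon> \<Omega> N)
       \<longrightarrow> tau1_smooth_on (A0H H) V f"
  then show "tau2_smooth \<epsilon> \<Omega> f"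
    by (intro tau1_smooth_on_imp_tau2_smooth[OF assms(1,2)]) blast
qed

end
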